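(* Let $R>0$ and let $s>0$ be such that $\mu(B(0,s)) = e^{-R}$. Then $$D_{\mu,\rho}^{\infty}(R) = \int_{B(0,s)} \rho(\|x\|)\, d\mu(x).$$
   Context: Standing assumptions: $(E,\|\cdot\|)$ is a real separable Banach space of infinite dimension; $\mu$ is a non-atomic centered Gaussian Borel probability measure on $E$ whose support is all of $E$; $\rho:[0,\infty[\to[0,\infty[$ is a surjective, strictly increasing, continuous map with $\rho(0)=0$, and $\int_E \rho(\|x\|)\,d\mu(x)<\infty$. For $a\in E$, $s>0$, $B(a,s)=\{x\in E:\|x-a\|\le s\}$ is the closed ball. A quantizer is a Borel-measurable map $f:E\to E$ whose image $f(E)$ is countable (finite or countably infinite); $\mathcal F$ is the set of all quantizers. The R\'enyi-$\infty$-entropy of $f$ with respect to $\mu$ is $H_\mu^\infty(f) = -\log\big(\max\{\mu(f^{-1}(z)) : z\in f(E)\}\big)$ (natural logarithm). The quantization error of $f$ is $D_{\mu,\rho}(f)=\int_E \rho(\|x-f(x)\|)\,d\mu(x)$, and for $R\ge 0$ the optimal quantization error is $$D_{\mu,\rho}^{\infty}(R)=\inf\{D_{\mu,\rho}(f): f\in\mathcal F,\ H_\mu^\infty(f)\le R\}.$$ *)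

theory Defs
  imports "HOL-Probability.Probability"
begin

definition infinite_dimensional :: "'a::real_vector itself \<Rightarrow> bool" where
  "infinite_dimensional _ \<longleftrightarrow> \<not> (\<exists>B :: 'a set. finite B \<and> span B = UNIV)"

(* The law of every continuous linear functional is N(0, sigma^2); the degenerate case sigma = 0,
   for which normal_density is not a density, is the Dirac measure at 0. *)
definition centered_gaussian :: "'a::real_normed_vector measure \<Rightarrow> bool" where
  "centered_gaussian M \<longleftrightarrow> prob_space M \<and> sets M = sets borel \<and>
     (\<forall>\<phi> :: 'a \<Rightarrow> real. bounded_linear \<phi> \<longrightarrow>
        distr M borel \<phi> = return borel 0 \<or>
        (\<exists>\<sigma>>0. distr M borel \<phi> = density lborel (\<lambda>t. ennreal (normal_density 0 \<sigma> t))))"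

definition atom :: "'a measure \<Rightarrow> 'a set \<Rightarrow> bool" where
  "atom M A \<longleftrightarrow> A \<in> sets M \<and> emeasure M A > 0 \<and>
     (\<forall>B\<in>sets M. B \<subseteq> A \<longrightarrow> emeasure M B = 0 \<or> emeasure M (A - B) = 0)"

definition nonatomic :: "'a measure \<Rightarrow> bool" where
  "nonatomic M \<longleftrightarrow> \<not> (\<exists>A. atom M A)"

definition measure_support :: "'a::topological_space measure \<Rightarrow> 'a set" where
  "measure_support M = {x. \<forall>U. open U \<and> x \<in> U \<longrightarrow> emeasure M U > 0}"

definition quantizers :: "('a::topological_space \<Rightarrow> 'a) set" where
  "quantizers = {f \<in> borel \<rightarrow>\<^sub>M borel. countable (range f)}"

(* Max is only meaningful on finite sets, whereas the image of a quantizer may be infinite.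
   GREATEST denotes the actual maximum, whose existence is quantizer_max_attained below. *)
definition renyi_inf_entropy :: "'a measure \<Rightarrow> ('a \<Rightarrow> 'a) \<Rightarrow> real" where
  "renyi_inf_entropy M f =
     - ln (GREATEST m. m \<in> {measure M (f -` {z}) | z. z \<in> range f})"

(* Errors take values in ennreal, since the error of an individual quantizer may be infinite. *)
definition quantization_error ::
    "'a::real_normed_vector measure \<Rightarrow> (real \<Rightarrow> real) \<Rightarrow> ('a \<Rightarrow> 'a) \<Rightarrow> ennreal" where
  "quantization_error M \<rho> f = (\<integral>\<^sup>+ x. ennreal (\<rho> (norm (x - f x))) \<partial>M)"

definition optimal_quantization_error ::
    "'a::real_normed_vector measure \<Rightarrow> (real \<Rightarrow> real) \<Rightarrow> real \<Rightarrow> ennreal" where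
  "optimal_quantization_error M \<rho> R =
     Inf {quantization_error M \<rho> f | f. f \<in> quantizers \<and> renyi_inf_entropy M f \<le> R}"

lemma quantizer_max_attained:
  fixes M :: "'a::t1_space measure"
  assumes "prob_space M" and sM: "sets M = sets borel" and f: "f \<in> quantizers"
  shows "\<exists>z\<in>range f. measure M (f -` {z}) > 0 \<and>
           (\<forall>w\<in>range f. measure M (f -` {w}) \<le> measure M (f -` {z}))"
proof -
  interpret prob_space M by fact
  have spM: "space M = UNIV" using sets_eq_imp_space_eq[OF sM] by simp
  have cf: "countable (range f)" and mf: "f \<in> borel \<rightarrow>\<^sub>M borel"
    using f by (auto simp: quantizers_def)
  define p where "p = (\<lambda>z. measure M (f -` {z}))"
  have meas: "f -` A \<in> sets M" if "A \<in> sets borel" for A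
    using measurable_sets[OF mf that] by (simp add: sM)
  have sumle: "(\<Sum>z\<in>F. p z) \<le> 1" if "finite F" for F
  proof -
    have "(\<Sum>z\<in>F. p z) = measure M (\<Union>z\<in>F. f -` {z})"
      unfolding p_def using that
      by (intro finite_measure_finite_Union[symmetric])
         (auto simp: disjoint_family_on_def intro!: meas)
    then show ?thesis by simp
  qed
  have ex: "\<exists>z\<in>range f. p z > 0"
  proof (rule ccontr)
    assume "\<not> ?thesis"
    then have z: "f -` {z} \<in> null_sets M" if "z \<in> range f" for z
      using that meas[of "{z}"] measure_nonneg[of M "f -` {z}"]
      by (auto simp: p_def null_sets_def emeasure_eq_measure not_less intro: antisym)
    have "(\<Union>z\<in>range f. f -` {z}) \<in> null_sets M"
      using cf z by (rule null_sets_UN')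
    moreover have "(\<Union>z\<in>range f. f -` {z}) = space M" by (auto simp: spM)
    ultimately show False using emeasure_space_1 by (auto simp: null_sets_def)
  qed
  then obtain z0 where z0: "z0 \<in> range f" "p z0 > 0" by blast
  define A where "A = {z \<in> range f. p z0 \<le> p z}"
  have "finite A"
  proof (rule ccontr)
    assume inf: "infinite A"
    obtain n :: nat where n: "1 < real n * p z0" using reals_Archimedean3[OF z0(2)] by blast
    obtain F where F: "F \<subseteq> A" "finite F" "card F = n"
      using infinite_arbitrarily_large[OF inf] by blast
    have "real n * p z0 = (\<Sum>z\<in>F. p z0)" using F by simp
    also have "\<dots> \<le> (\<Sum>z\<in>F. p z)" using F by (intro sum_mono) (auto simp: A_def)
    also have "\<dots> \<le> 1" by (rule sumle) fact
    finally show False using n by simp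
  qed
  moreover have "A \<noteq> {}" using z0 by (auto simp: A_def)
  ultimately obtain z where z: "z \<in> A" "\<And>w. w \<in> A \<Longrightarrow> p w \<le> p z"
    using Max_in[of "p ` A"] Max_ge[of "p ` A"] by fastforce
  show ?thesis
  proof (intro bexI[of _ z] conjI ballI)
    show "z \<in> range f" using z by (simp add: A_def)
    have "p z0 \<le> p z" using z by (simp add: A_def)
    then show "measure M (f -` {z}) > 0" using z0 by (simp add: p_def)
    fix w assume "w \<in> range f"
    then show "measure M (f -` {w}) \<le> measure M (f -` {z})"
      using z by (cases "w \<in> A") (auto simp: A_def p_def)
  qed
qed

end

theory Submission
  imports Defs
begin

text \<open>A quantizer of entropy at most \<open>R\<close> has a cell \<open>A\<close>, quantized to some \<open>z\<close>, of mass at least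
  \<open>exp (- R) = \<mu> (B(0, s))\<close>. Anderson's inequality \<open>\<mu> (B(z, r)) \<le> \<mu> (B(0, r))\<close> and the layer cake formula
  show that the error on \<open>A\<close> alone is at least the integral over \<open>B(0, s)\<close>. Conversely, the quantizer that
  collapses \<open>B(0, s)\<close> to the origin and moves all other points by at most \<open>\<delta>\<close> has error at most that integral plus
  \<open>\<rho> \<delta>\<close>.

  Anderson's inequality: by Hahn--Banach a ball is a countable intersection of slabs. Finitely many functionals
  are combinations of an \<open>L\<^sup>2\<close>-orthonormal family, whose law is a product of standard normals; for
  these the Prekopa--Leindler inequality compares a slab intersection and its reflection
  with the centred one.\<close>

section \<open>Norming functionals\<close>

text \<open>The entropy bound asks for one large cell and leaves all others free, so points outside
  that cell can be quantized arbitrarily well at no cost. What remains is to collect mass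
  \<open>exp (- R)\<close> around one point as cheaply as possible. A quantizer has countable image
  and so cannot simply fix the points outside the ball; this is where the extra
  \<open>\<rho> \<delta>\<close> comes from.

  The obstacle to Anderson's inequality is that an infinite-dimensional space has no Lebesgue
  measure, while \<open>centered_gaussian\<close> prescribes only one-dimensional laws. Joint laws
  are recovered because a linear combination of functionals is again a functional, whose
  characteristic function is known.

  Only the midpoint case of Prekopa--Leindler is used: the centred set contains all midpoints
  between a shifted set and its reflection. In the form
  \<open>f x * g y \<le> (h ((x + y) / 2))\<^sup>2\<close> hypothesis and conclusion have the same
  shape, which lets the inequality be iterated over coordinates.\<close>

definition sublinear :: "('a::real_vector \<Rightarrow> real) \<Rightarrow> bool" where
  "sublinear p \<longleftrightarrow> (\<forall>x y. p (x + y) \<le> p x + p y) \<and> (\<forall>c x. c > 0 \<longrightarrow> p (c *\<^sub>R x) = c * p x)"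

lemma sublinear_add: "sublinear p \<Longrightarrow> p (x + y) \<le> p x + p y"
  and sublinear_scale: "sublinear p \<Longrightarrow> c > 0 \<Longrightarrow> p (c *\<^sub>R x) = c * p x"
  by (auto simp: sublinear_def)

lemma sublinear_0: assumes "sublinear p" shows "p 0 = 0"
  using sublinear_scale[OF assms, of 2 0] by simp

lemma sublinear_ge_minus: assumes "sublinear p" shows "- p (- x) \<le> p x"
  using sublinear_add[OF assms, of x "-x"] sublinear_0[OF assms] by simp

text \<open>Carries positive homogeneity over to infima: over the parameter of
  \<open>flatten\<close>, and over a chain of sublinear functionals.\<close>

lemma cINF_mult_left:
  fixes f :: "'b \<Rightarrow> real"
  assumes "c > 0" "S \<noteq> {}" "bdd_below (f ` S)"
  shows "(INF x\<in>S. c * f x) = c * (INF x\<in>S. f x)"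
proof (rule antisym)
  have bd: "bdd_below ((\<lambda>x. c * f x) ` S)"
  proof -
    obtain m where "\<And>x. x \<in> S \<Longrightarrow> m \<le> f x" using assms(3) by (auto simp: bdd_below_def)
    then show ?thesis using assms(1) by (intro bdd_belowI2[of _ "c * m"]) (simp add: mult_left_mono)
  qed
  have "(INF x\<in>S. c * f x) / c \<le> (INF x\<in>S. f x)"
    using assms(1,2) cINF_lower[OF bd] by (intro cINF_greatest) (auto simp: field_simps)
  then show "(INF x\<in>S. c * f x) \<le> c * (INF x\<in>S. f x)" using assms(1) by (simp add: field_simps)
  show "c * (INF x\<in>S. f x) \<le> (INF x\<in>S. c * f x)"
    using assms by (intro cINF_greatest) (auto intro!: mult_left_mono cINF_lower)
qed

text \<open>A sublinear functional with \<open>flatten p y \<le> p\<close> and \<open>flatten p y (- y) \<le> - p y\<close>, so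
  a minimal \<open>p\<close> equals its own flattening and is additive.\<close>

definition flatten :: "('a::real_vector \<Rightarrow> real) \<Rightarrow> 'a \<Rightarrow> 'a \<Rightarrow> real" where
  "flatten p y x = (INF t\<in>{0..}. p (x + t *\<^sub>R y) - t * p y)"

text \<open>Splitting \<open>t *\<^sub>R y\<close> as \<open>(x + t *\<^sub>R y) + - x\<close>
  bounds every term from below by \<open>- p (- x)\<close>, so the infimum in \<open>flatten\<close>
  is a genuine one.\<close>

lemma flatten_bdd_below:
  assumes p: "sublinear p"
  shows "bdd_below ((\<lambda>t. p (x + t *\<^sub>R y) - t * p y) ` {0..})"
proof -
  have "- p (- x) \<le> p (x + t *\<^sub>R y) - t * p y" if "t \<ge> 0" for t
  proof (cases "t = 0")
    case False
    then have "t * p y = p (t *\<^sub>R y)" using that sublinear_scale[OF p, of t y] by simp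
    also have "\<dots> = p ((x + t *\<^sub>R y) + - x)" by simp
    also have "\<dots> \<le> p (x + t *\<^sub>R y) + p (- x)" by (rule sublinear_add[OF p])
    finally show ?thesis by simp
  qed (simp add: sublinear_ge_minus[OF p])
  then show ?thesis
    by (intro bdd_belowI2[of _ "- p (- x)"]) auto
qed

lemma flatten_le:
  assumes "sublinear p" and "t \<ge> 0"
  shows "flatten p y x \<le> p (x + t *\<^sub>R y) - t * p y"
  unfolding flatten_def using assms(2) by (intro cINF_lower[OF flatten_bdd_below[OF assms(1)]]) auto

text \<open>Subadditivity: a parameter \<open>t\<close> for \<open>x\<close> and \<open>u\<close>
  for \<open>z\<close> combine to \<open>t + u\<close> for \<open>x + z\<close>, and the two infima
  are then taken one after the other. Homogeneity: multiplication by \<open>c\<close> permutes the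
  index set \<open>{0..}\<close>.\<close>

lemma sublinear_flatten:
  assumes p: "sublinear p"
  shows "sublinear (flatten p y)"
  unfolding sublinear_def
proof (intro conjI allI impI)
  fix x z
  have *: "flatten p y (x + z) \<le> (p (x + t *\<^sub>R y) - t * p y) + (p (z + u *\<^sub>R y) - u * p y)"
    if "t \<ge> 0" "u \<ge> 0" for t u
  proof -
    have "flatten p y (x + z) \<le> p ((x + z) + (t + u) *\<^sub>R y) - (t + u) * p y"
      using that by (intro flatten_le[OF p]) simp
    also have "(x + z) + (t + u) *\<^sub>R y = (x + t *\<^sub>R y) + (z + u *\<^sub>R y)"
      by (simp add: algebra_simps)
    finally show ?thesis
      using sublinear_add[OF p, of "x + t *\<^sub>R y" "z + u *\<^sub>R y"] by (simp add: algebra_simps)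
  qed
  have "flatten p y (x + z) - (p (z + u *\<^sub>R y) - u * p y) \<le> flatten p y x" if "u \<ge> 0" for u
    unfolding flatten_def[of p y x] using *[OF _ that] by (intro cINF_greatest) (auto simp: field_simps)
  then have "flatten p y (x + z) - flatten p y x \<le> flatten p y z"
    unfolding flatten_def[of p y z] by (intro cINF_greatest) (auto simp: field_simps)
  then show "flatten p y (x + z) \<le> flatten p y x + flatten p y z" by simp
next
  fix c :: real and x assume c: "c > 0"
  have surj: "(\<lambda>t. c * t) ` {0..} = {0..}"
  proof (intro set_eqI iffI)
    fix t :: real assume "t \<in> {0..}"
    then show "t \<in> (*) c ` {0..}" using c by (intro image_eqI[of _ _ "t / c"]) auto
  qed (use c in auto)
  have "flatten p y (c *\<^sub>R x) = (INF t\<in>(\<lambda>t. c * t) ` {0..}. p (c *\<^sub>R x + t *\<^sub>R y) - t * p y)"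
    unfolding surj flatten_def ..
  also have "\<dots> = (INF t\<in>{0..}. c * (p (x + t *\<^sub>R y) - t * p y))"
    using sublinear_scale[OF p c] unfolding image_image
    by (intro INF_cong refl) (metis (no_types, opaque_lifting) mult.assoc right_diff_distrib scaleR_add_right scaleR_scaleR)
  also have "\<dots> = c * flatten p y x"
    unfolding flatten_def by (intro cINF_mult_left c flatten_bdd_below[OF p]) auto
  finally show "flatten p y (c *\<^sub>R x) = c * flatten p y x" .
qed

lemma minimal_sublinear_linear:
  assumes p: "sublinear p" and min: "\<And>q. sublinear q \<Longrightarrow> (\<And>x. q x \<le> p x) \<Longrightarrow> q = p"
  shows "linear p"
proof -
  have "flatten p y = p" for y
  proof (rule min[OF sublinear_flatten[OF p]])
    show "flatten p y x \<le> p x" for x using flatten_le[OF p, of 0 y x] by simp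
  qed
  \<comment> \<open>The parameter 1 gives \<open>p x \<le> p (x + y) - p y\<close>, the converse of
    subadditivity.\<close>
  then have "p x + p y \<le> p (x + y)" for x y using flatten_le[OF p, of 1 y x] by simp
  then have add: "p (x + y) = p x + p y" for x y
    using sublinear_add[OF p] by (intro antisym)
  have neg: "p (- x) = - p x" for x
    using add[of x "-x"] sublinear_0[OF p] by simp
  show ?thesis
  proof (rule linearI)
    show "p (x + y) = p x + p y" for x y by (rule add)
    show "p (c *\<^sub>R x) = c *\<^sub>R p x" for c x
    proof (cases c "0::real" rule: linorder_cases)
      case less
      then show ?thesis using neg[of "(-c) *\<^sub>R x"] sublinear_scale[OF p, of "-c" x] by simp
    qed (use sublinear_0[OF p] sublinear_scale[OF p] in auto)
  qed
qed

text \<open>Zorn's lemma for the reversed pointwise order. The bound of a nonempty chain is its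
  pointwise infimum, finite because every member is at least \<open>- p0 (- x)\<close> at
  \<open>x\<close>.\<close>

lemma minimal_sublinear_exists:
  fixes p0 :: "'a::real_vector \<Rightarrow> real"
  assumes p0: "sublinear p0"
  obtains p where "sublinear p" "\<And>x. p x \<le> p0 x"
    "\<And>q. sublinear q \<Longrightarrow> (\<And>x. q x \<le> p x) \<Longrightarrow> q = p"
proof -
  define A where "A = {p. sublinear p \<and> p \<le> p0}"
  have "\<exists>m\<in>A. \<forall>a\<in>A. m \<ge> a \<longrightarrow> a = m"
  proof (rule predicate_Zorn)
    show "partial_order_on A (relation_of (\<ge>) A)"
      by (rule partial_order_on_relation_ofI) auto
  next
    fix C assume C: "C \<in> Chains (relation_of (\<ge>) A)"
    then have CA: "C \<subseteq> A" by (rule Chains_relation_of)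
    have cmp: "p \<le> q \<or> q \<le> p" if "p \<in> C" "q \<in> C" for p q
      using C that by (auto simp: Chains_def relation_of_def)
    show "\<exists>u\<in>A. \<forall>a\<in>C. u \<le> a"
    proof (cases "C = {}")
      case True
      then show ?thesis using p0 by (auto simp: A_def)
    next
      case False
      define u where "u = (\<lambda>x. INF p\<in>C. p x)"
      have sub: "sublinear p" and le: "p x \<le> p0 x" if "p \<in> C" for p x
        using CA that by (auto simp: A_def le_fun_def)
      have bd: "bdd_below ((\<lambda>p. p x) ` C)" for x
      proof (rule bdd_belowI2)
        fix p assume "p \<in> C"
        then show "- p0 (- x) \<le> p x"
          using sublinear_ge_minus[OF sub, of p x] le[of p "-x"] by linarith
      qed
      have ule: "u x \<le> p x" if "p \<in> C" for p x
        unfolding u_def using that by (intro cINF_lower bd)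
      have "u (x + y) \<le> u x + u y" for x y
      proof -
        have *: "u (x + y) \<le> p x + q y" if "p \<in> C" "q \<in> C" for p q
        proof -
          have "p \<le> q \<or> q \<le> p" using cmp that .
          \<comment> \<open>Here the chain property enters: the smaller of \<open>p\<close> and
            \<open>q\<close> serves both \<open>x\<close> and \<open>y\<close>.\<close>
          then obtain r where r: "r \<in> C" "r \<le> p" "r \<le> q" using \<open>p \<in> C\<close> \<open>q \<in> C\<close> by auto
          have "u (x + y) \<le> r (x + y)" using r by (intro ule)
          also have "\<dots> \<le> r x + r y" using sub[OF r(1)] by (rule sublinear_add)
          also have "\<dots> \<le> p x + q y" using r by (intro add_mono) (auto simp: le_fun_def)
          finally show ?thesis .
        qed
        have "u (x + y) - q y \<le> u x" if "q \<in> C" for q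
          unfolding u_def using * that False
          by (intro cINF_greatest) (auto simp: u_def field_simps)
        then have "u (x + y) - u x \<le> u y"
          unfolding u_def[THEN fun_cong, of y] using False
          by (intro cINF_greatest) (auto simp: field_simps)
        then show ?thesis by simp
      qed
      moreover have "u (c *\<^sub>R x) = c * u x" if "c > 0" for c x
      proof -
        have "u (c *\<^sub>R x) = (INF p\<in>C. c * p x)"
          unfolding u_def using sublinear_scale[OF sub that] by (intro INF_cong) auto
        also have "\<dots> = c * u x" unfolding u_def by (intro cINF_mult_left that False bd)
        finally show ?thesis .
      qed
      ultimately have "sublinear u" by (auto simp: sublinear_def)
      moreover have "u \<le> p0"
      proof (rule le_funI)
        fix x
        obtain p where "p \<in> C" using False by auto
        then show "u x \<le> p0 x" using ule[of p x] le[of p x] by linarith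
      qed
      ultimately have "u \<in> A" by (simp add: A_def)
      then show ?thesis using ule by (auto simp: le_fun_def)
    qed
  qed
  then obtain m where m: "m \<in> A" "\<And>a. a \<in> A \<Longrightarrow> a \<le> m \<Longrightarrow> a = m" by auto
  show thesis
  proof
    show "sublinear m" "m x \<le> p0 x" for x using m(1) by (auto simp: A_def le_fun_def)
    fix q :: "'a \<Rightarrow> real" assume q: "sublinear q" "\<And>x. q x \<le> m x"
    then have "q \<le> m" by (simp add: le_fun_def)
    moreover have "q \<le> p0" using m(1) \<open>q \<le> m\<close> by (auto simp: A_def)
    ultimately show "q = m" using q by (intro m(2)) (auto simp: A_def)
  qed
qed

text \<open>The minimal functional is sought below \<open>flatten norm y\<close> rather than below
  the norm itself: parameter 0 keeps it below the norm, and parameter 1 at \<open>- y\<close> forces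
  the value at \<open>y\<close> up to \<open>norm y\<close>.\<close>

lemma norming_functional_exists:
  fixes y :: "'a::real_normed_vector"
  obtains \<phi> :: "'a \<Rightarrow> real" where "bounded_linear \<phi>" "\<And>x. \<bar>\<phi> x\<bar> \<le> norm x" "\<phi> y = norm y"
proof -
  have N: "sublinear (norm :: 'a \<Rightarrow> real)"
    by (auto simp: sublinear_def norm_triangle_ineq)
  obtain p where p: "sublinear p" "\<And>x. p x \<le> flatten norm y x"
    "\<And>q. sublinear q \<Longrightarrow> (\<And>x. q x \<le> p x) \<Longrightarrow> q = p"
    using minimal_sublinear_exists[OF sublinear_flatten[OF N, of y]] by blast
  have lin: "linear p" by (rule minimal_sublinear_linear[OF p(1,3)])
  have le: "p x \<le> norm x" for x using p(2)[of x] flatten_le[OF N, of 0 y x] by simp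
  have abs: "\<bar>p x\<bar> \<le> norm x" for x using le[of x] le[of "-x"] linear_neg[OF lin, of x] by simp
  have "p (- y) \<le> - norm y" using p(2)[of "-y"] flatten_le[OF N, of 1 y "-y"] by simp
  then have "p y = norm y" using le[of y] linear_neg[OF lin, of y] by simp
  moreover have "bounded_linear p"
    by (rule bounded_linear_intro[of p 1]) (use lin abs in \<open>auto simp: linear_add linear_cmul\<close>)
  ultimately show thesis using abs that by blast
qed

text \<open>It suffices to norm the points of a countable dense set. All the functionals are
  1-Lipschitz, so replacing \<open>x\<close> by a dense point \<open>y\<close> costs at most twice
  their distance, whence the radius \<open>e/2\<close>.\<close>

lemma countable_norming_functionals:
  obtains \<phi> :: "nat \<Rightarrow> 'a::{real_normed_vector, second_countable_topology} \<Rightarrow> real"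
  where "\<And>n. bounded_linear (\<phi> n)" "\<And>x t. norm x \<le> t \<longleftrightarrow> (\<forall>n. \<bar>\<phi> n x\<bar> \<le> t)"
proof -
  obtain D :: "'a set" where D: "countable D" "\<And>X. open X \<Longrightarrow> X \<noteq> {} \<Longrightarrow> \<exists>d\<in>D. d \<in> X"
    using countable_dense_setE by blast
  have "D \<noteq> {}" using D(2)[of UNIV] by auto
  define d where "d = from_nat_into D"
  have "\<exists>\<phi> :: 'a \<Rightarrow> real. bounded_linear \<phi> \<and> (\<forall>x. \<bar>\<phi> x\<bar> \<le> norm x) \<and> \<phi> (d n) = norm (d n)" for n
    using norming_functional_exists[of "d n"] by metis
  then obtain \<phi> :: "nat \<Rightarrow> 'a \<Rightarrow> real" where
    \<phi>: "\<And>n. bounded_linear (\<phi> n)" "\<And>n x. \<bar>\<phi> n x\<bar> \<le> norm x" "\<And>n. \<phi> n (d n) = norm (d n)"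
    by metis
  show thesis
  proof
    fix x :: 'a and t
    show "norm x \<le> t \<longleftrightarrow> (\<forall>n. \<bar>\<phi> n x\<bar> \<le> t)"
    proof (intro iffI allI)
      assume *: "\<forall>n. \<bar>\<phi> n x\<bar> \<le> t"
      have "norm x \<le> t + e" if "e > 0" for e
      proof -
        obtain y where y: "y \<in> D" "y \<in> ball x (e/2)" using D(2)[of "ball x (e/2)"] \<open>e > 0\<close> by auto
        then obtain n where n: "d n = y"
          using D(1) \<open>D \<noteq> {}\<close> by (metis d_def from_nat_into_surj)
        have "norm x \<le> norm y + norm (x - y)" by (rule norm_triangle_sub)
        also have "norm y = \<phi> n x + \<phi> n (y - x)"
          using \<phi>(3)[of n] by (simp add: n linear_diff[OF bounded_linear.linear[OF \<phi>(1)]])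
        also have "\<phi> n (y - x) \<le> norm (x - y)" using \<phi>(2)[of n "y - x"] by (simp add: norm_minus_commute)
        also have "\<phi> n x \<le> t" using *[rule_format, of n] by simp
        finally show ?thesis using y by (simp add: dist_norm)
      qed
      then show "norm x \<le> t" by (rule field_le_epsilon)
    qed (use \<phi>(2) order_trans in blast)
  qed (rule \<phi>(1))
qed

section \<open>Prekopa--Leindler inequality for product Gaussians\<close>

text \<open>A nonnegative \<open>f x\<close> is the length of \<open>{0..<f x}\<close>, and Fubini
  swaps the integrals. Negative values are allowed: \<open>ennreal\<close> and the restriction to
  \<open>t \<ge> 0\<close> both turn them into 0.\<close>

lemma (in sigma_finite_measure) nn_integral_layer_cake:
  assumes [measurable]: "f \<in> borel_measurable M"
  shows "(\<integral>\<^sup>+ x. ennreal (f x) \<partial>M) = (\<integral>\<^sup>+ t. indicator {0..} t * emeasure M {x\<in>space M. t < f x} \<partial>lborel)"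
proof -
  interpret pair_sigma_finite lborel M ..
  have "(\<integral>\<^sup>+ x. ennreal (f x) \<partial>M) = (\<integral>\<^sup>+ x. (\<integral>\<^sup>+ t. indicator {0..} t * indicator {x\<in>space M. t < f x} x \<partial>lborel) \<partial>M)"
  proof (intro nn_integral_cong)
    fix x assume x: "x \<in> space M"
    have "(\<integral>\<^sup>+ t. indicator {0..} t * indicator {x\<in>space M. t < f x} x \<partial>lborel) = (\<integral>\<^sup>+ t. indicator {0..<f x} t \<partial>lborel)"
      using x by (intro nn_integral_cong) (auto split: split_indicator)
    then show "ennreal (f x) = (\<integral>\<^sup>+ t. indicator {0..} t * indicator {x\<in>space M. t < f x} x \<partial>lborel)"
      by (cases "f x \<ge> 0") (auto simp: ennreal_neg)
  qed
  also have "\<dots> = (\<integral>\<^sup>+ t. (\<integral>\<^sup>+ x. indicator {0..} t * indicator {x\<in>space M. t < f x} x \<partial>M) \<partial>lborel)"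
    by (rule Fubini') measurable
  also have "\<dots> = (\<integral>\<^sup>+ t. indicator {0..} t * emeasure M {x\<in>space M. t < f x} \<partial>lborel)"
    by (intro nn_integral_cong) (simp add: nn_integral_cmult)
  finally show ?thesis .
qed

section \<open>One-dimensional Brunn--Minkowski inequality\<close>

lemma emeasure_lborel_translate:
  fixes A :: "real set"
  assumes [measurable]: "A \<in> sets borel"
  shows "emeasure lborel {x. x - c \<in> A} = emeasure lborel A"
proof -
  have "emeasure lborel A = emeasure (distr lborel borel ((+) (- c))) A"
    by (simp add: lborel_distr_plus)
  also have "\<dots> = emeasure lborel {x. x - c \<in> A}"
    by (subst emeasure_distr) (auto simp: vimage_def)
  finally show ?thesis ..
qed

lemma emeasure_lborel_double:
  fixes A :: "real set"
  assumes [measurable]: "A \<in> sets borel"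
  shows "emeasure lborel {x. x / 2 \<in> A} = 2 * emeasure lborel A"
proof -
  have "emeasure lborel {x. x / 2 \<in> A} = emeasure (density (distr lborel borel ((*) 2)) (\<lambda>_. \<bar>2\<bar>)) {x. x / 2 \<in> A}"
    using lborel_distr_mult'[of 2] by simp
  also have "\<dots> = 2 * emeasure lborel A"
    by (subst emeasure_density) (auto simp: nn_integral_cmult nn_integral_distr emeasure_distr vimage_def)
  finally show ?thesis .
qed

text \<open>The translates \<open>A + b\<close> and \<open>a + B\<close> both lie in the doubled set \<open>2 C\<close>; if \<open>a\<close> is close
  to \<open>Sup A\<close> and \<open>b\<close> to \<open>Inf B\<close>, they overlap only in a short interval.\<close>

lemma Brunn_Minkowski_bounded:
  fixes A B C :: "real set"
  assumes [measurable]: "A \<in> sets borel" "B \<in> sets borel" "C \<in> sets borel"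
    and ne: "A \<noteq> {}" "B \<noteq> {}" and bd: "bdd_above A" "bdd_below B"
    and mid: "\<And>a b. a \<in> A \<Longrightarrow> b \<in> B \<Longrightarrow> (a + b) / 2 \<in> C"
  shows "emeasure lborel A + emeasure lborel B \<le> 2 * emeasure lborel C"
proof (rule ennreal_le_epsilon)
  fix e :: real assume e: "e > 0"
  obtain a where a: "a \<in> A" "Sup A - e / 2 < a" using less_cSupD[OF ne(1), of "Sup A - e / 2"] e by auto
  obtain b where b: "b \<in> B" "b < Inf B + e / 2" using cInf_lessD[OF ne(2), of "Inf B + e / 2"] e by auto
  define S where "S = {x. x - b \<in> A}"
  define T where "T = {x. x - a \<in> B}"
  \<comment> \<open>\<open>S\<close> lies below \<open>Sup A + b\<close> and \<open>T\<close> above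
    \<open>a + Inf B\<close>, so \<open>J\<close> contains the overlap; its length
    \<open>(Sup A - a) + (b - Inf B)\<close> is less than \<open>e\<close>.\<close>
  define J where "J = {a + Inf B .. Sup A + b}"
  have [measurable]: "S \<in> sets borel" "T \<in> sets borel" "J \<in> sets borel" unfolding S_def T_def J_def by measurable
  have ST: "S \<union> T \<subseteq> {x. x / 2 \<in> C}"
    using mid[OF _ b(1)] mid[OF a(1)] by (auto simp: S_def T_def) (metis diff_add_cancel, metis add.commute diff_add_cancel)
  have SJ: "S \<inter> T \<subseteq> J"
    using cSup_upper[OF _ bd(1)] cInf_lower[OF _ bd(2)] by (fastforce simp: S_def T_def J_def field_simps)
  have "emeasure lborel T \<le> emeasure lborel ((T - S) \<union> J)"
    using SJ by (intro emeasure_mono) auto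
  also have "\<dots> \<le> emeasure lborel (T - S) + emeasure lborel J" by (intro emeasure_subadditive) auto
  also have "emeasure lborel J \<le> ennreal e"
    using a b cSup_upper[OF a(1) bd(1)] cInf_lower[OF b(1) bd(2)] unfolding J_def by (subst emeasure_lborel_Icc) (auto intro!: ennreal_leI)
  finally have T: "emeasure lborel T \<le> emeasure lborel (T - S) + ennreal e" by (simp add: add_left_mono)
  have "emeasure lborel A + emeasure lborel B = emeasure lborel S + emeasure lborel T"
    unfolding S_def T_def by (simp add: emeasure_lborel_translate)
  also have "\<dots> \<le> emeasure lborel S + emeasure lborel (T - S) + ennreal e"
    using T by (simp add: add.assoc add_left_mono)
  also have "emeasure lborel S + emeasure lborel (T - S) = emeasure lborel (S \<union> T)"
    by (subst plus_emeasure) (auto simp: Un_Diff_cancel)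
  also have "\<dots> \<le> emeasure lborel {x. x / 2 \<in> C}"
    by (intro emeasure_mono ST) auto
  also have "\<dots> = 2 * emeasure lborel C" by (simp add: emeasure_lborel_double)
  finally show "emeasure lborel A + emeasure lborel B \<le> 2 * emeasure lborel C + ennreal e"
    by (simp add: add_right_mono)
qed

lemma Brunn_Minkowski_real:
  fixes A B C :: "real set"
  assumes [measurable]: "A \<in> sets borel" "B \<in> sets borel" "C \<in> sets borel"
    and ne: "A \<noteq> {}" "B \<noteq> {}"
    and mid: "\<And>a b. a \<in> A \<Longrightarrow> b \<in> B \<Longrightarrow> (a + b) / 2 \<in> C"
  shows "emeasure lborel A + emeasure lborel B \<le> 2 * emeasure lborel C"
proof -
  obtain a b where ab: "a \<in> A" "b \<in> B" using ne by auto
  \<comment> \<open>The offset keeps \<open>a\<close> and \<open>b\<close> in every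
    \<open>I n\<close>: the bounded case needs nonempty sets, since \<open>mid\<close> says nothing
    when one of them is empty.\<close>
  define I where "I n = {- (\<bar>a\<bar> + \<bar>b\<bar> + real n) .. \<bar>a\<bar> + \<bar>b\<bar> + real n}" for n
  have lim: "(\<lambda>n. emeasure lborel (X \<inter> I n)) \<longlonglongrightarrow> emeasure lborel X" if [measurable]: "X \<in> sets borel" for X :: "real set"
  proof -
    have "(\<Union>n. X \<inter> I n) = X"
    proof (intro equalityI subsetI)
      fix x assume "x \<in> X"
      obtain n where "\<bar>x\<bar> \<le> real n" using real_arch_simple by blast
      with \<open>x \<in> X\<close> have "x \<in> X \<inter> I n" by (auto simp: I_def)
      then show "x \<in> (\<Union>n. X \<inter> I n)" by blast
    qed auto
    moreover have "incseq (\<lambda>n. X \<inter> I n)" by (auto simp: incseq_def I_def)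
    moreover have "range (\<lambda>n. X \<inter> I n) \<subseteq> sets lborel" by (auto simp: I_def)
    ultimately show ?thesis
      using Lim_emeasure_incseq[of "\<lambda>n. X \<inter> I n" lborel] by simp
  qed
  have "emeasure lborel (A \<inter> I n) + emeasure lborel (B \<inter> I n) \<le> 2 * emeasure lborel C" for n
  proof (rule Brunn_Minkowski_bounded)
    have "a \<in> I n" "b \<in> I n" by (auto simp: I_def)
    then show "A \<inter> I n \<noteq> {}" "B \<inter> I n \<noteq> {}" using ab by auto
    show "bdd_above (A \<inter> I n)" "bdd_below (B \<inter> I n)"
      by (auto simp: I_def bdd_above_def bdd_below_def)
    show "A \<inter> I n \<in> sets borel" "B \<inter> I n \<in> sets borel" unfolding I_def by auto
  qed (use mid in auto)
  moreover have "(\<lambda>n. emeasure lborel (A \<inter> I n) + emeasure lborel (B \<inter> I n)) \<longlonglongrightarrow> emeasure lborel A + emeasure lborel B"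
    by (intro tendsto_add lim) auto
  ultimately show ?thesis by (intro LIMSEQ_le_const2) auto
qed

text \<open>Brunn--Minkowski is applied to superlevel sets and integrated over the levels. Dividing
  \<open>f\<close> and \<open>g\<close> by their suprema makes both superlevel sets nonempty for
  exactly the levels \<open>t < 1\<close>, and the geometric mean \<open>c\<close> is the matching
  scale for \<open>h\<close>. The resulting bound on a sum becomes one on a product by
  \<open>4 * (u * v) \<le> (u + v)\<^sup>2\<close>.\<close>

lemma Prekopa_Leindler_real:
  fixes f g h :: "real \<Rightarrow> real"
  assumes f: "integrable lborel f" "\<And>x. 0 \<le> f x" "\<And>x. f x \<le> K"
    and g: "integrable lborel g" "\<And>x. 0 \<le> g x" "\<And>x. g x \<le> K"
    and h: "integrable lborel h" "\<And>x. 0 \<le> h x"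
    and mid: "\<And>x y. f x * g y \<le> (h ((x + y) / 2))\<^sup>2"
  shows "(LINT x|lborel. f x) * (LINT x|lborel. g x) \<le> (LINT x|lborel. h x)\<^sup>2"
proof -
  note [measurable] = borel_measurable_integrable[OF f(1)] borel_measurable_integrable[OF g(1)]
    borel_measurable_integrable[OF h(1)]
  define a where "a = (SUP x. f x)"
  define b where "b = (SUP x. g x)"
  have bd: "bdd_above (range f)" "bdd_above (range g)" using f(3) g(3) by (auto simp: bdd_above_def)
  have fa: "f x \<le> a" and gb: "g x \<le> b" for x
    unfolding a_def b_def by (auto intro: cSUP_upper bd)
  show ?thesis
  proof (cases "a \<le> 0 \<or> b \<le> 0")
    case True
    then have "(\<forall>x. f x = 0) \<or> (\<forall>x. g x = 0)"
      using fa gb f(2) g(2) by (meson order_antisym order_trans)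
    then show ?thesis by auto
  next
    case False
    then have ab: "a > 0" "b > 0" by auto
    define c where "c = sqrt (a * b)"
    have c: "c > 0" "c\<^sup>2 = a * b" using ab by (auto simp: c_def)
    have level: "emeasure lborel {x. t < f x / a} + emeasure lborel {x. t < g x / b}
        \<le> 2 * emeasure lborel {x. t < h x / c}" if t: "t \<ge> 0" for t
    proof (cases "t < 1")
      case True
      show ?thesis
      proof (rule Brunn_Minkowski_real)
        have "a * t < a" "b * t < b" using ab True by auto
        then obtain x y where "a * t < f x" "b * t < g y"
          unfolding a_def b_def using less_cSUP_iff[OF _ bd(1)] less_cSUP_iff[OF _ bd(2)] by auto
        then show "{x. t < f x / a} \<noteq> {}" "{x. t < g x / b} \<noteq> {}" using ab by (auto simp: field_simps)
        fix x y assume "x \<in> {x. t < f x / a}" "y \<in> {x. t < g x / b}"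
        then have "t < f x / a" "t < g y / b" by auto
        then have "t * t < (f x / a) * (g y / b)" using t by (intro mult_strict_mono') auto
        also have "\<dots> \<le> (h ((x + y) / 2) / c)\<^sup>2"
          using mid[of x y] ab c by (simp add: power_divide divide_right_mono)
        finally have "t < h ((x + y) / 2) / c"
          using h(2) c by (auto simp: power2_eq_square[symmetric] intro: power2_less_imp_less)
        then show "(x + y) / 2 \<in> {x. t < h x / c}" by simp
      qed measurable
    next
      case False
      have "f x / a \<le> 1" "g x / b \<le> 1" for x using fa gb ab by auto
      then have "{x. t < f x / a} = {}" "{x. t < g x / b} = {}"
        using False by (force simp: not_less intro: order_trans)+
      then show ?thesis by simp
    qed
    have "(\<integral>\<^sup>+ x. ennreal (f x / a) \<partial>lborel) + (\<integral>\<^sup>+ x. ennreal (g x / b) \<partial>lborel)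
        \<le> 2 * (\<integral>\<^sup>+ x. ennreal (h x / c) \<partial>lborel)"
      using level
      by (subst (1 2 3) lborel.nn_integral_layer_cake)
         (auto simp: nn_integral_add[symmetric] nn_integral_cmult[symmetric] split: split_indicator intro!: nn_integral_mono)
    also have "(\<integral>\<^sup>+ x. ennreal (f x / a) \<partial>lborel) = ennreal ((LINT x|lborel. f x) / a)"
      using ab f by (subst nn_integral_eq_integral) auto
    also have "(\<integral>\<^sup>+ x. ennreal (g x / b) \<partial>lborel) = ennreal ((LINT x|lborel. g x) / b)"
      using ab g by (subst nn_integral_eq_integral) auto
    also have "(\<integral>\<^sup>+ x. ennreal (h x / c) \<partial>lborel) = ennreal ((LINT x|lborel. h x) / c)"
      using c h by (subst nn_integral_eq_integral) auto
    also have "ennreal ((LINT x|lborel. f x) / a) + ennreal ((LINT x|lborel. g x) / b) =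
        ennreal ((LINT x|lborel. f x) / a + (LINT x|lborel. g x) / b)"
      using ab f g by (intro ennreal_plus[symmetric]) (auto simp: integral_nonneg_AE)
    also have "2 * ennreal ((LINT x|lborel. h x) / c) = ennreal (2 * ((LINT x|lborel. h x) / c))"
      by (subst ennreal_mult') simp_all
    finally have le: "(LINT x|lborel. f x) / a + (LINT x|lborel. g x) / b \<le> 2 * ((LINT x|lborel. h x) / c)"
      (is "?F + ?G \<le> 2 * ?H")
      using c h(2) by (subst (asm) ennreal_le_iff) (auto simp: integral_nonneg_AE)
    have "?F \<ge> 0" "?G \<ge> 0" using ab f g by (auto simp: integral_nonneg_AE)
    have "4 * (u * v) \<le> (u + v)\<^sup>2" for u v :: real
      using zero_le_power2[of "u - v"] by (simp add: power2_eq_square algebra_simps)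
    then have "4 * (?F * ?G) \<le> (?F + ?G)\<^sup>2" .
    also have "\<dots> \<le> (2 * ?H)\<^sup>2" using le \<open>?F \<ge> 0\<close> \<open>?G \<ge> 0\<close> by (intro power_mono) auto
    finally have "?F * ?G \<le> ?H\<^sup>2" by (simp add: power2_eq_square)
    then show ?thesis using ab c by (simp add: power_divide divide_le_cancel)
  qed
qed

text \<open>The normal density is log-concave, so multiplying \<open>f\<close>, \<open>g\<close> and
  \<open>h\<close> by it preserves the midpoint hypothesis and reduces the claim to Lebesgue
  measure.\<close>

lemma Prekopa_Leindler_std_normal:
  fixes f g h :: "real \<Rightarrow> real"
  assumes [measurable]: "f \<in> borel_measurable borel" "g \<in> borel_measurable borel" "h \<in> borel_measurable borel"
    and f: "\<And>x. 0 \<le> f x \<and> f x \<le> 1" and g: "\<And>x. 0 \<le> g x \<and> g x \<le> 1" and h: "\<And>x. 0 \<le> h x \<and> h x \<le> 1"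
    and mid: "\<And>x y. f x * g y \<le> (h ((x + y) / 2))\<^sup>2"
  shows "(LINT x|std_normal_distribution. f x) * (LINT x|std_normal_distribution. g x)
    \<le> (LINT x|std_normal_distribution. h x)\<^sup>2"
proof -
  let ?d = std_normal_density
  have d1: "?d x \<le> 1" for x
  proof -
    have "1 / sqrt (2 * pi) \<le> 1" using pi_ge_two by (simp add: real_le_rsqrt)
    then show ?thesis unfolding std_normal_density_def by (intro mult_le_one) auto
  qed
  have int: "integrable lborel (\<lambda>x. ?d x * u x)" if [measurable]: "u \<in> borel_measurable borel" and u: "\<And>x. 0 \<le> u x \<and> u x \<le> 1" for u
    by (rule Bochner_Integration.integrable_bound[OF integrable_normal_density[of 1 0]])
       (use u in \<open>auto simp: abs_mult intro!: mult_left_le\<close>)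
  have exp_mid: "?d x * ?d y \<le> (?d ((x + y) / 2))\<^sup>2" for x y
  proof -
    \<comment> \<open>The right side exceeds the left one by
      \<open>(x - y)\<^sup>2 / 4\<close>.\<close>
    have "- x\<^sup>2 / 2 + - y\<^sup>2 / 2 \<le> 2 * (- ((x + y) / 2)\<^sup>2 / 2)"
      using zero_le_power2[of "x - y"] by (simp add: power2_eq_square field_simps)
    then have "exp (- x\<^sup>2 / 2) * exp (- y\<^sup>2 / 2) \<le> (exp (- ((x + y) / 2)\<^sup>2 / 2))\<^sup>2"
      by (simp only: exp_add[symmetric] exp_double[symmetric] exp_le_cancel_iff)
    then show ?thesis
      unfolding std_normal_density_def power_mult_distrib
      by (simp add: power2_eq_square field_simps divide_right_mono)
  qed
  have "(LINT x|lborel. ?d x * f x) * (LINT x|lborel. ?d x * g x) \<le> (LINT x|lborel. ?d x * h x)\<^sup>2"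
  proof (rule Prekopa_Leindler_real[where K=1])
    fix x y
    have "?d x * f x * (?d y * g y) = (?d x * ?d y) * (f x * g y)" by simp
    also have "\<dots> \<le> (?d ((x + y) / 2))\<^sup>2 * (h ((x + y) / 2))\<^sup>2"
      using f g by (intro mult_mono exp_mid mid) auto
    finally show "?d x * f x * (?d y * g y) \<le> (?d ((x + y) / 2) * h ((x + y) / 2))\<^sup>2"
      by (simp add: power_mult_distrib)
  qed (use f g h d1 int in \<open>auto intro!: mult_le_one\<close>)
  then show ?thesis by (simp add: integral_density)
qed

text \<open>Induction by integrating out one coordinate. For fixed \<open>x\<close> and
  \<open>y\<close> the one-dimensional inequality, applied to the sections, shows that the partial
  integrals satisfy the midpoint hypothesis on the smaller index set; Fubini gives back the full
  integrals.\<close>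

lemma Prekopa_Leindler_PiM_std_normal:
  fixes f g h :: "('i \<Rightarrow> real) \<Rightarrow> real"
  defines "P \<equiv> \<lambda>I. PiM I (\<lambda>_::'i. std_normal_distribution)"
  assumes "finite I"
    and "f \<in> borel_measurable (P I)" "g \<in> borel_measurable (P I)" "h \<in> borel_measurable (P I)"
    and "\<And>x. 0 \<le> f x \<and> f x \<le> 1" "\<And>x. 0 \<le> g x \<and> g x \<le> 1" "\<And>x. 0 \<le> h x \<and> h x \<le> 1"
    and "\<And>x y. x \<in> space (P I) \<Longrightarrow> y \<in> space (P I) \<Longrightarrow> f x * g y \<le> (h (\<lambda>i\<in>I. (x i + y i) / 2))\<^sup>2"
  shows "(LINT x|P I. f x) * (LINT x|P I. g x) \<le> (LINT x|P I. h x)\<^sup>2"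
  using assms(2-)
proof (induction I arbitrary: f g h rule: finite_induct)
  case empty
  interpret product_prob_space "\<lambda>_::'i. std_normal_distribution"
    by (intro product_prob_spaceI prob_space_normal_density) simp
  have "f (\<lambda>_. undefined) * g (\<lambda>_. undefined) \<le> (h (\<lambda>_. undefined))\<^sup>2"
    using empty.prems(7)[of "\<lambda>_. undefined" "\<lambda>_. undefined"] by (simp add: P_def space_PiM restrict_def)
  then show ?case by (simp add: P_def PiM_empty lebesgue_integral_count_space_finite)
next
  case (insert i I)
  interpret product_prob_space "\<lambda>_::'i. std_normal_distribution"
    by (intro product_prob_spaceI prob_space_normal_density) simp
  interpret PI: prob_space "P I" unfolding P_def by (intro prob_space_PiM prob_space_normal_density) simp
  interpret PJ: prob_space "P (insert i I)" unfolding P_def by (intro prob_space_PiM prob_space_normal_density) simp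
  define E where "E u x = (LINT t|std_normal_distribution. u (x(i := t)))" for u :: "('i \<Rightarrow> real) \<Rightarrow> real" and x
  have Em: "E u \<in> borel_measurable (P I)" and Efub: "(LINT x|P (insert i I). u x) = (LINT x|P I. E u x)"
    and E01: "0 \<le> E u x \<and> E u x \<le> 1"
    and Emx: "x \<in> space (P I) \<Longrightarrow> (\<lambda>t. u (x(i := t))) \<in> borel_measurable borel"
    if um[measurable]: "u \<in> borel_measurable (P (insert i I))" and u: "\<And>x. 0 \<le> u x \<and> u x \<le> 1" for u x
  proof -
    have [measurable]: "u \<in> borel_measurable (PiM (insert i I) (\<lambda>_. std_normal_distribution))" using um by (simp add: P_def)
    show "E u \<in> borel_measurable (P I)"
      unfolding E_def P_def by measurable
    show "(LINT x|P (insert i I). u x) = (LINT x|P I. E u x)"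
      unfolding E_def P_def using insert.hyps
    proof (rule product_integral_insert)
      show "integrable (PiM (insert i I) (\<lambda>_. std_normal_distribution)) u"
        using u PJ.integrable_const_bound[of u 1] um by (simp add: P_def)
    qed
    show "0 \<le> E u x \<and> E u x \<le> 1"
    proof
      show "0 \<le> E u x" unfolding E_def using u by (auto intro: integral_nonneg_AE)
      have "(\<integral>\<^sup>+t. ennreal (u (x(i := t))) \<partial>std_normal_distribution) \<le> (\<integral>\<^sup>+t. 1 \<partial>std_normal_distribution)"
        using u by (intro nn_integral_mono) simp
      then show "E u x \<le> 1"
        unfolding E_def using prob_space.emeasure_space_1[OF prob_space_normal_density[of 1 0]] by (intro integral_real_bounded) simp_all
    qed
    show "(\<lambda>t. u (x(i := t))) \<in> borel_measurable borel" if "x \<in> space (P I)"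
    proof -
      have "(\<lambda>t. u (x(i := t))) \<in> borel_measurable std_normal_distribution" using that unfolding P_def by measurable
      then show ?thesis by simp
    qed
  qed
  show ?case
    unfolding Efub[OF insert.prems(1,4)] Efub[OF insert.prems(2,5)] Efub[OF insert.prems(3,6)]
  proof (rule insert.IH)
    fix x y assume xy: "x \<in> space (P I)" "y \<in> space (P I)"
    define z where "z = (\<lambda>i\<in>I. (x i + y i) / 2)"
    have z: "z \<in> space (P I)" by (auto simp: z_def P_def space_PiM)
    show "E f x * E g y \<le> (E h z)\<^sup>2"
      unfolding E_def
    proof (rule Prekopa_Leindler_std_normal)
      fix s t
      have "f (x(i := s)) * g (y(i := t)) \<le> (h (\<lambda>j\<in>insert i I. ((x(i := s)) j + (y(i := t)) j) / 2))\<^sup>2"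
        using xy by (intro insert.prems(7)) (auto simp: P_def space_PiM PiE_iff extensional_def)
      also have "(\<lambda>j\<in>insert i I. ((x(i := s)) j + (y(i := t)) j) / 2) = z(i := (s + t) / 2)"
        using insert.hyps by (auto simp: z_def fun_eq_iff restrict_def)
      finally show "f (x(i := s)) * g (y(i := t)) \<le> (h (z(i := (s + t) / 2)))\<^sup>2" .
    qed (use insert.prems Emx xy z in auto)
  qed (use insert.prems Em E01 in auto)
qed

section \<open>Joint laws of Gaussian functionals\<close>

lemma prob_space_std_normal: "prob_space std_normal_distribution"
  by (rule prob_space_normal_density) simp

text \<open>Levy's theorem speaks of probability laws, so the weight is normalized by its mass,
  which \<open>char\<close> at \<open>t = 0\<close> identifies as \<open>c\<close>. If
  \<open>c = 0\<close>, both sides vanish.\<close>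

lemma (in prob_space) weighted_std_normal:
  fixes w Y :: "'a \<Rightarrow> real"
  assumes [measurable]: "w \<in> borel_measurable M" "Y \<in> borel_measurable M" "B \<in> sets borel"
    and w: "\<And>x. 0 \<le> w x" "\<And>x. w x \<le> K"
    and char: "\<And>t. (CLINT x|M. of_real (w x) * iexp (t * Y x)) = of_real (c * exp (- t\<^sup>2 / 2))"
  shows "(LINT x|M. w x * indicator B (Y x)) = c * measure std_normal_distribution B"
proof -
  have wint: "integrable M w"
    by (rule integrable_const_bound[of _ K]) (use w in auto)
  have "complex_of_real (LINT x|M. w x) = of_real c"
    using char[of 0] by simp
  then have c: "(LINT x|M. w x) = c" by (simp only: of_real_eq_iff)
  have "c \<ge> 0" unfolding c[symmetric] using w by (auto intro: integral_nonneg_AE)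
  then consider "c = 0" | "c > 0" by linarith
  then show ?thesis
  proof cases
    case 1
    have "(LINT x|M. w x * indicator B (Y x)) \<le> (LINT x|M. w x)"
      using w by (intro integral_mono Bochner_Integration.integrable_bound[OF wint] wint)
        (auto split: split_indicator)
    moreover have "(LINT x|M. w x * indicator B (Y x)) \<ge> 0"
      using w by (intro integral_nonneg_AE) auto
    ultimately show ?thesis using c 1 by simp
  next
    case 2
    define N where "N = density M (\<lambda>x. ennreal (w x / c))"
    have "emeasure N (space N) = ennreal ((LINT x|M. w x) / c)"
      unfolding N_def using w 2 wint
      by (simp add: emeasure_density nn_integral_eq_integral cong: nn_integral_cong)
    then interpret N: prob_space N using c 2 by (intro prob_spaceI) simp
    have [measurable_cong]: "sets N = sets M" by (simp add: N_def)
    have "char (distr N borel Y) = char std_normal_distribution"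
    proof
      fix t
      have "char (distr N borel Y) t = (CLINT x|M. (w x / c) *\<^sub>R iexp (t * Y x))"
        unfolding char_def using w 2 by (subst integral_distr) (auto simp: N_def integral_density)
      also have "\<dots> = (CLINT x|M. (of_real (w x) * iexp (t * Y x)) / c)"
        by (intro Bochner_Integration.integral_cong) (auto simp: scaleR_conv_of_real)
      also have "\<dots> = exp (- t\<^sup>2 / 2)"
        using char[of t] 2 by simp
      finally show "char (distr N borel Y) t = char std_normal_distribution t"
        by (simp add: char_std_normal_distribution)
    qed
    then have D: "distr N borel Y = std_normal_distribution"
      by (intro Levy_uniqueness real_dist_normal_dist N.real_distribution_distr) auto
    have "measure (distr N borel Y) B = (LINT x|N. indicator B (Y x))"
      using integral_distr[of Y N borel "indicator B :: real \<Rightarrow> real"] by simp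
    also have "\<dots> = (LINT x|M. (w x / c) * indicator B (Y x))"
      unfolding N_def using w 2 by (subst integral_density) auto
    also have "\<dots> = (LINT x|M. w x * indicator B (Y x)) / c" by simp
    finally show ?thesis using 2 D by (simp add: field_simps)
  qed
qed

text \<open>The coordinates are converted one at a time from Fourier variables \<open>a j\<close> to events \<open>B j\<close>.
  Levy's uniqueness theorem needs a nonnegative weight, so the remaining exponential
  \<open>iexp L\<close> is recovered from the weights \<open>1 + cos (L + \<theta>)\<close> with \<open>\<theta> = 0\<close> and \<open>\<theta> = - pi / 2\<close>.\<close>

lemma (in prob_space) std_normal_joint_mixed:
  fixes Y :: "nat \<Rightarrow> 'a \<Rightarrow> real"
  assumes Y[measurable]: "\<And>j. Y j \<in> borel_measurable M"
    and char: "\<And>a. (CLINT x|M. iexp (\<Sum>j<m. a j * Y j x)) = of_real (exp (- (\<Sum>j<m. (a j)\<^sup>2) / 2))"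
    and "k \<le> m" and B[measurable]: "\<And>j. B j \<in> sets borel"
  shows "(CLINT x|M. of_real (\<Prod>j<k. indicator (B j) (Y j x)) * iexp (\<Sum>j\<in>{k..<m}. a j * Y j x)) =
    of_real ((\<Prod>j<k. measure std_normal_distribution (B j)) * exp (- (\<Sum>j\<in>{k..<m}. (a j)\<^sup>2) / 2))"
  using \<open>k \<le> m\<close>
proof (induction k arbitrary: a)
  case 0
  show ?case using char[of a] by (simp add: lessThan_atLeast0)
next
  case (Suc k)
  define w where "w x = (\<Prod>j<k. indicator (B j) (Y j x) :: real)" for x
  define L where "L x = (\<Sum>j\<in>{Suc k..<m}. a j * Y j x)" for x
  define p where "p = (\<Prod>j<k. measure std_normal_distribution (B j))"
  define q where "q = (\<Sum>j\<in>{Suc k..<m}. (a j)\<^sup>2)"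
  define n where "n = measure std_normal_distribution (B k)"
  have [measurable]: "w \<in> borel_measurable M" "L \<in> borel_measurable M"
    unfolding w_def L_def by measurable
  have w01: "0 \<le> w x" "w x \<le> 1" for x
    unfolding w_def by (auto intro!: prod_nonneg prod_le_1)
  have int: "integrable M (\<lambda>x. of_real (w x) * iexp (Z x))" if [measurable]: "Z \<in> borel_measurable M" for Z
    by (rule integrable_const_bound[of _ 1]) (use w01 in \<open>auto simp: norm_mult\<close>)
  \<comment> \<open>The scale \<open>s\<close> supplies all terms of the cosine weight at once:
    \<open>s = 0\<close> for the constant 1, and \<open>s = 1\<close>, \<open>s = -1\<close> for the
    two exponentials in the cosine.\<close>
  have IH: "(CLINT x|M. of_real (w x) * iexp (t * Y k x + s * L x)) = of_real (p * exp (- (t\<^sup>2 + s\<^sup>2 * q) / 2))" for s t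
  proof -
    have km: "{k..<m} = insert k {Suc k..<m}" using Suc.prems by auto
    define b where "b j = (if j = k then t else s * a j)" for j
    have "(\<Sum>j\<in>{k..<m}. b j * Y j x) = t * Y k x + s * L x" for x
      unfolding km L_def sum_distrib_left
      by (subst sum.insert) (auto simp: b_def intro!: sum.cong)
    moreover have "(\<Sum>j\<in>{k..<m}. (b j)\<^sup>2) = t\<^sup>2 + s\<^sup>2 * q"
      unfolding km q_def sum_distrib_left
      by (subst sum.insert) (auto simp: b_def power_mult_distrib intro!: sum.cong)
    ultimately show ?thesis using Suc.IH[of b] Suc.prems by (simp add: w_def p_def)
  qed
  have W0: "(LINT x|M. w x * indicator (B k) (Y k x)) = p * n"
    unfolding n_def
    by (rule weighted_std_normal[where K=1]) (use w01 IH[of _ 0] in auto)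
  have W: "(LINT x|M. (w x * (1 + cos (L x + \<theta>))) * indicator (B k) (Y k x)) = p * (1 + cos \<theta> * exp (- q / 2)) * n" for \<theta>
    unfolding n_def
  proof (rule weighted_std_normal[where K=2])
    fix x
    show "0 \<le> w x * (1 + cos (L x + \<theta>))" using w01(1)[of x] cos_ge_minus_one[of "L x + \<theta>"]
      by (intro mult_nonneg_nonneg) linarith+
    show "w x * (1 + cos (L x + \<theta>)) \<le> 2" using w01[of x] cos_le_one[of "L x + \<theta>"] cos_ge_minus_one[of "L x + \<theta>"]
      mult_mono[of "w x" 1 "1 + cos (L x + \<theta>)" 2] by linarith
  next
    fix t
    have cosE: "complex_of_real (cos u) = (iexp u + iexp (- u)) / 2" for u
      by (simp add: cos_of_real[symmetric] cos_exp_eq)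
    define Z where "Z s x = of_real (w x) * iexp (t * Y k x + s * L x)" for s x
    have Z: "integrable M (Z s)" for s unfolding Z_def by (intro int) measurable
    have "of_real (w x * (1 + cos (L x + \<theta>))) * iexp (t * Y k x) =
      Z 0 x + (iexp \<theta> / 2 * Z 1 x + iexp (- \<theta>) / 2 * Z (-1) x)" for x
      unfolding of_real_mult of_real_add cosE Z_def
      by (simp add: exp_add exp_diff exp_minus field_simps)
    then have "(CLINT x|M. of_real (w x * (1 + cos (L x + \<theta>))) * iexp (t * Y k x)) =
      (CLINT x|M. Z 0 x + (iexp \<theta> / 2 * Z 1 x + iexp (- \<theta>) / 2 * Z (-1) x))"
      by (simp only:)
    also have "\<dots> = (CLINT x|M. Z 0 x) + (iexp \<theta> / 2 * (CLINT x|M. Z 1 x) + iexp (- \<theta>) / 2 * (CLINT x|M. Z (-1) x))"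
      by (simp only: Z Bochner_Integration.integral_add Bochner_Integration.integrable_add integrable_mult_right integral_mult_right_zero)
    also have "\<dots> = of_real (p * exp (- (t\<^sup>2 + 0\<^sup>2 * q) / 2)) +
      (iexp \<theta> / 2 * of_real (p * exp (- (t\<^sup>2 + 1\<^sup>2 * q) / 2)) +
       iexp (- \<theta>) / 2 * of_real (p * exp (- (t\<^sup>2 + (-1)\<^sup>2 * q) / 2)))"
      unfolding Z_def IH ..
    also have "\<dots> = of_real (p * exp (- t\<^sup>2 / 2)) + (iexp \<theta> + iexp (- \<theta>)) / 2 * of_real (p * exp (- (t\<^sup>2 + q) / 2))"
      by (simp add: field_simps)
    also have "\<dots> = of_real (p * (1 + cos \<theta> * exp (- q / 2)) * exp (- t\<^sup>2 / 2))"
    proof -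
      have "exp (- (t\<^sup>2 + q) / 2) = exp (- q / 2) * exp (- t\<^sup>2 / 2)"
        by (simp add: exp_add[symmetric] field_simps)
      then show ?thesis
        unfolding cosE[symmetric] of_real_mult[symmetric] of_real_add[symmetric]
        by (simp add: algebra_simps)
    qed
    finally show "(CLINT x|M. of_real (w x * (1 + cos (L x + \<theta>))) * iexp (t * Y k x)) =
      of_real (p * (1 + cos \<theta> * exp (- q / 2)) * exp (- t\<^sup>2 / 2))" .
  qed measurable
  have intr: "integrable M (\<lambda>x. w x * indicator (B k) (Y k x) * v x)" if [measurable]: "v \<in> borel_measurable M" and "\<And>x. \<bar>v x\<bar> \<le> 1" for v
    by (rule integrable_const_bound[of _ 1]) (use w01 that in \<open>auto simp: abs_mult split: split_indicator intro!: mult_le_one\<close>)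
  \<comment> \<open>Subtracting \<open>W0\<close> removes the 1 that was added to make the weight
    nonnegative.\<close>
  have C: "(LINT x|M. w x * indicator (B k) (Y k x) * cos (L x + \<theta>)) = p * cos \<theta> * exp (- q / 2) * n" for \<theta>
  proof -
    have "(LINT x|M. w x * indicator (B k) (Y k x) * cos (L x + \<theta>)) =
      (LINT x|M. (w x * (1 + cos (L x + \<theta>))) * indicator (B k) (Y k x) - w x * indicator (B k) (Y k x) * 1)"
      by (intro Bochner_Integration.integral_cong) (auto simp: algebra_simps)
    also have "\<dots> = (LINT x|M. (w x * (1 + cos (L x + \<theta>))) * indicator (B k) (Y k x)) - (LINT x|M. w x * indicator (B k) (Y k x) * 1)"
    proof (rule Bochner_Integration.integral_diff)
      have "integrable M (\<lambda>x. w x * indicator (B k) (Y k x) * 1 + w x * indicator (B k) (Y k x) * cos (L x + \<theta>))"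
        by (intro Bochner_Integration.integrable_add intr) auto
      then show "integrable M (\<lambda>x. w x * (1 + cos (L x + \<theta>)) * indicator (B k) (Y k x))"
        by (simp add: algebra_simps)
    qed (intro intr; simp)
    finally show ?thesis unfolding W using W0 by (simp add: algebra_simps)
  qed
  have Cc: "(LINT x|M. w x * indicator (B k) (Y k x) * cos (L x)) = p * n * exp (- q / 2)"
    using C[of 0] by simp
  have Cs: "(LINT x|M. w x * indicator (B k) (Y k x) * sin (L x)) = 0"
    using C[of "- (pi / 2)"] by (simp add: cos_diff cos_add)
  have "of_real (\<Prod>j<Suc k. indicator (B j) (Y j x)) * iexp (L x) =
    of_real (w x * indicator (B k) (Y k x) * cos (L x)) + \<i> * of_real (w x * indicator (B k) (Y k x) * sin (L x))" for x
    unfolding exp_Euler by (simp add: w_def algebra_simps cos_of_real sin_of_real)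
  then have "(CLINT x|M. of_real (\<Prod>j<Suc k. indicator (B j) (Y j x)) * iexp (L x)) =
    (CLINT x|M. of_real (w x * indicator (B k) (Y k x) * cos (L x))) + (CLINT x|M. \<i> * of_real (w x * indicator (B k) (Y k x) * sin (L x)))"
    by (simp only:) (intro Bochner_Integration.integral_add integrable_mult_right integrable_of_real intr; simp)
  also have "\<dots> = of_real (p * n * exp (- q / 2))"
    using Cc Cs by (simp only: integral_mult_right_zero integral_complex_of_real) simp
  finally show ?case unfolding L_def p_def n_def q_def by simp
qed

text \<open>With all \<open>m\<close> coordinates converted no Fourier variable is left, and the
  mixed formula gives the mass of every measurable box; boxes determine a product measure.\<close>

lemma (in prob_space) distr_PiM_std_normal:
  fixes Y :: "nat \<Rightarrow> 'a \<Rightarrow> real"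
  assumes Y[measurable]: "\<And>j. Y j \<in> borel_measurable M"
    and char: "\<And>a. (CLINT x|M. iexp (\<Sum>j<m. a j * Y j x)) = of_real (exp (- (\<Sum>j<m. (a j)\<^sup>2) / 2))"
  shows "distr M (PiM {..<m} (\<lambda>_. std_normal_distribution)) (\<lambda>x. \<lambda>j\<in>{..<m}. Y j x) =
    PiM {..<m} (\<lambda>_. std_normal_distribution)"
proof -
  note em = emeasure_eq_measure
  note mixed = std_normal_joint_mixed[OF Y char order_refl]
  interpret product_prob_space "\<lambda>_::nat. std_normal_distribution"
    by (intro product_prob_spaceI prob_space_std_normal)
  have [measurable]: "(\<lambda>x. \<lambda>j\<in>{..<m}. Y j x) \<in> M \<rightarrow>\<^sub>M PiM {..<m} (\<lambda>_. std_normal_distribution)"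
    by (rule measurable_restrict) simp
  show ?thesis
  proof (rule PiM_eqI)
    fix A :: "nat \<Rightarrow> real set" assume A: "\<And>i. i \<in> {..<m} \<Longrightarrow> A i \<in> sets std_normal_distribution"
    \<comment> \<open>\<open>A\<close> is known to be Borel only below \<open>m\<close>, whereas the
      mixed formula asks for Borel sets at every index.\<close>
    define B where "B j = (if j < m then A j else {})" for j
    have B[measurable]: "B j \<in> sets borel" for j using A by (auto simp: B_def)
    have "(CLINT x|M. of_real (\<Prod>j<m. indicator (B j) (Y j x))) =
      of_real (\<Prod>j<m. measure std_normal_distribution (B j))"
      using mixed[where B=B and a="\<lambda>_. 0", OF B] by simp
    then have int: "(LINT x|M. (\<Prod>j<m. indicator (B j) (Y j x))) = (\<Prod>j<m. measure std_normal_distribution (B j))"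
      by (simp only: integral_complex_of_real of_real_eq_iff)
    have "emeasure (distr M (PiM {..<m} (\<lambda>_. std_normal_distribution)) (\<lambda>x. \<lambda>j\<in>{..<m}. Y j x)) (Pi\<^sub>E {..<m} A) =
      emeasure M {x\<in>space M. \<forall>j<m. Y j x \<in> B j}"
      using A by (subst emeasure_distr) (auto simp: B_def intro!: sets_PiM_I_finite arg_cong2[where f=emeasure])
    also have "\<dots> = ennreal (LINT x|M. indicator {x\<in>space M. \<forall>j<m. Y j x \<in> B j} x)"
      by (simp add: em)
    also have "(LINT x|M. indicator {x\<in>space M. \<forall>j<m. Y j x \<in> B j} x) = (LINT x|M. (\<Prod>j<m. indicator (B j) (Y j x) :: real))"
    proof (intro Bochner_Integration.integral_cong refl)
      fix x assume "x \<in> space M"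
      then show "indicator {x\<in>space M. \<forall>j<m. Y j x \<in> B j} x = (\<Prod>j<m. indicator (B j) (Y j x) :: real)"
      proof (cases "\<forall>j<m. Y j x \<in> B j")
        case False
        then obtain j where "j < m" "Y j x \<notin> B j" by blast
        then have "(\<Prod>j<m. indicator (B j) (Y j x) :: real) = 0"
          by (intro prod_zero) (auto intro!: bexI[of _ j])
        then show ?thesis using False by simp
      qed simp
    qed
    also have "ennreal \<dots> = (\<Prod>j<m. ennreal (measure std_normal_distribution (B j)))"
      unfolding int by (rule prod_ennreal[symmetric]) simp
    also have "\<dots> = (\<Prod>j<m. emeasure std_normal_distribution (A j))"
    proof (rule prod.cong[OF refl])
      fix j assume "j \<in> {..<m}"
      then have "B j = A j" by (simp add: B_def)
      then show "ennreal (measure std_normal_distribution (B j)) = emeasure std_normal_distribution (A j)"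
        by (simp only: finite_measure.emeasure_eq_measure[OF prob_space.finite_measure[OF prob_space_std_normal]])
    qed
    finally show "emeasure (distr M (PiM {..<m} (\<lambda>_. std_normal_distribution)) (\<lambda>x. \<lambda>j\<in>{..<m}. Y j x)) (Pi\<^sub>E {..<m} A) =
      (\<Prod>j<m. emeasure std_normal_distribution (A j))" .
  qed auto
qed

section \<open>Bounded functionals under a centred Gaussian measure\<close>

context
  fixes \<mu> :: "'a::real_normed_vector measure"
  assumes gauss: "centered_gaussian \<mu>"
begin

lemma centered_gaussian_prob_space: "prob_space \<mu>"
  and centered_gaussian_sets: "sets \<mu> = sets borel"
  using gauss by (auto simp: centered_gaussian_def)

lemma centered_gaussian_space: "space \<mu> = UNIV"
  using sets_eq_imp_space_eq[OF centered_gaussian_sets] by simp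

lemma bounded_linear_measurable_gaussian:
  fixes \<phi> :: "'a \<Rightarrow> real"
  assumes "bounded_linear \<phi>"
  shows "\<phi> \<in> borel_measurable \<mu>"
proof -
  have "\<phi> \<in> borel_measurable borel"
    using assms by (intro borel_measurable_continuous_onI linear_continuous_on)
  then show ?thesis using centered_gaussian_sets by (simp cong: measurable_cong_sets)
qed

text \<open>Expressing the characteristic function through the second moment covers the Dirac law
  and the normal laws by one formula. Frequency 1 is enough, as multiples of \<phi> are functionals
  too. For \<open>\<sigma> > 0\<close> a rescaling reduces to the standard normal law.\<close>

lemma centered_gaussian_second_moment_char:
  fixes \<phi> :: "'a \<Rightarrow> real"
  assumes \<phi>: "bounded_linear \<phi>"
  shows "integrable \<mu> (\<lambda>x. (\<phi> x)\<^sup>2)"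
    and "(CLINT x|\<mu>. iexp (\<phi> x)) = of_real (exp (- (LINT x|\<mu>. (\<phi> x)\<^sup>2) / 2))"
proof -
  note [measurable] = bounded_linear_measurable_gaussian[OF \<phi>]
  interpret prob_space \<mu> by (rule centered_gaussian_prob_space)
  have "integrable \<mu> (\<lambda>x. (\<phi> x)\<^sup>2) \<and>
    (CLINT x|\<mu>. iexp (\<phi> x)) = of_real (exp (- (LINT x|\<mu>. (\<phi> x)\<^sup>2) / 2))"
  proof -
    have "distr \<mu> borel \<phi> = return borel 0 \<or>
        (\<exists>\<sigma>>0. distr \<mu> borel \<phi> = density lborel (\<lambda>t. ennreal (normal_density 0 \<sigma> t)))"
      using gauss \<phi> by (simp add: centered_gaussian_def)
    then consider "distr \<mu> borel \<phi> = return borel 0"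
      | \<sigma> where "\<sigma> > 0" "distr \<mu> borel \<phi> = density lborel (\<lambda>t. ennreal (normal_density 0 \<sigma> t))"
      by blast
    then show ?thesis
    proof cases
      case 1
      have "AE y in return borel (0::real). y = 0" by (subst AE_return) auto
      then have "AE x in \<mu>. \<phi> x = 0"
        unfolding 1[symmetric] by (subst (asm) AE_distr_iff) auto
      then have sq: "AE x in \<mu>. (\<phi> x)\<^sup>2 = 0" and e: "AE x in \<mu>. iexp (\<phi> x) = 1"
        by (auto elim: AE_mp)
      have "integrable \<mu> (\<lambda>x. (\<phi> x)\<^sup>2) = integrable \<mu> (\<lambda>x. 0 :: real)"
        using sq by (intro integrable_cong_AE) auto
      moreover have "(LINT x|\<mu>. (\<phi> x)\<^sup>2) = (LINT x|\<mu>. 0)"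
        using sq by (intro integral_cong_AE) auto
      moreover have "(CLINT x|\<mu>. iexp (\<phi> x)) = (CLINT x|\<mu>. 1)"
        using e by (intro integral_cong_AE) auto
      ultimately show ?thesis by (simp add: prob_space)
    next
      case 2
      let ?D = "density lborel (\<lambda>t. ennreal (normal_density 0 \<sigma> t))"
      have sq: "integrable ?D (\<lambda>y. y\<^sup>2)"
        using integrable_normal_moment[OF 2(1), of 0 2] by (subst integrable_density) auto
      have int: "integrable \<mu> (\<lambda>x. (\<phi> x)\<^sup>2)"
        using sq unfolding 2(2)[symmetric] by (subst (asm) integrable_distr_eq) auto
      have "(LINT x|\<mu>. (\<phi> x)\<^sup>2) = (LINT y|?D. y\<^sup>2)"
        unfolding 2(2)[symmetric] by (subst integral_distr) auto
      then have var: "(LINT x|\<mu>. (\<phi> x)\<^sup>2) = \<sigma>\<^sup>2"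
        using integral_normal_moment_even[OF 2(1), of 0 1]
        by (simp add: integral_density fact_numeral)
      have "(CLINT x|\<mu>. iexp (\<phi> x)) = (CLINT y|?D. iexp y)"
        unfolding 2(2)[symmetric] by (subst integral_distr) auto
      then have "(CLINT x|\<mu>. iexp (\<phi> x)) = (CLINT y|lborel. normal_density 0 \<sigma> y *\<^sub>R iexp y)"
        by (simp add: integral_density)
      also have "\<dots> = \<bar>\<sigma>\<bar> *\<^sub>R (CLINT y|lborel. normal_density 0 \<sigma> (0 + \<sigma> * y) *\<^sub>R iexp (0 + \<sigma> * y))"
        using 2(1) by (intro lborel_integral_real_affine) auto
      also have "\<dots> = (CLINT y|lborel. \<bar>\<sigma>\<bar> *\<^sub>R (normal_density 0 \<sigma> (0 + \<sigma> * y) *\<^sub>R iexp (0 + \<sigma> * y)))"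
        by (rule integral_scaleR_right[symmetric])
      also have "\<dots> = (CLINT y|lborel. std_normal_density y *\<^sub>R iexp (\<sigma> * y))"
      proof (intro Bochner_Integration.integral_cong refl)
        fix y
        have "\<bar>\<sigma>\<bar> * normal_density 0 \<sigma> (0 + \<sigma> * y) = std_normal_density y"
          using 2(1) by (simp add: normal_density_def real_sqrt_mult power_mult_distrib)
        then show "\<bar>\<sigma>\<bar> *\<^sub>R (normal_density 0 \<sigma> (0 + \<sigma> * y) *\<^sub>R iexp (0 + \<sigma> * y)) = std_normal_density y *\<^sub>R iexp (\<sigma> * y)"
          by (metis add_0 scaleR_scaleR)
      qed
      also have "\<dots> = char std_normal_distribution \<sigma>"
        by (simp add: char_def integral_density)
      also have "\<dots> = of_real (exp (- \<sigma>\<^sup>2 / 2))" by (simp add: char_std_normal_distribution)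
      finally show ?thesis using int var by simp
    qed
  qed
  then show "integrable \<mu> (\<lambda>x. (\<phi> x)\<^sup>2)"
    and "(CLINT x|\<mu>. iexp (\<phi> x)) = of_real (exp (- (LINT x|\<mu>. (\<phi> x)\<^sup>2) / 2))" by auto
qed

lemma integrable_gaussian_mult:
  fixes \<phi> \<psi> :: "'a \<Rightarrow> real"
  assumes \<phi>: "bounded_linear \<phi>" and \<psi>: "bounded_linear \<psi>"
  shows "integrable \<mu> (\<lambda>x. \<phi> x * \<psi> x)"
proof (rule Bochner_Integration.integrable_bound)
  note [measurable] = bounded_linear_measurable_gaussian[OF \<phi>] bounded_linear_measurable_gaussian[OF \<psi>]
  show "integrable \<mu> (\<lambda>x. (\<phi> x)\<^sup>2 + (\<psi> x)\<^sup>2)"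
    by (intro Bochner_Integration.integrable_add centered_gaussian_second_moment_char assms)
  have "\<bar>\<phi> x * \<psi> x\<bar> \<le> (\<phi> x)\<^sup>2 + (\<psi> x)\<^sup>2" for x
    using sum_squares_bound[of "\<bar>\<phi> x\<bar>" "\<bar>\<psi> x\<bar>"] mult_nonneg_nonneg[OF abs_ge_zero abs_ge_zero, of "\<phi> x" "\<psi> x"]
    unfolding abs_mult power2_abs by linarith
  then show "AE x in \<mu>. norm (\<phi> x * \<psi> x) \<le> norm ((\<phi> x)\<^sup>2 + (\<psi> x)\<^sup>2)" by simp
  show "(\<lambda>x. \<phi> x * \<psi> x) \<in> borel_measurable \<mu>" by measurable
qed

text \<open>Zero variance gives \<phi> = 0 only almost everywhere. But
  \<open>{x. \<phi> x \<noteq> 0}\<close> is open and null, hence empty by full support.\<close>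

lemma gaussian_variance_zero:
  fixes \<phi> :: "'a \<Rightarrow> real"
  assumes supp: "measure_support \<mu> = UNIV" and \<phi>: "bounded_linear \<phi>" and "(LINT x|\<mu>. (\<phi> x)\<^sup>2) = 0"
  shows "\<phi> x = 0"
proof (rule ccontr)
  assume x: "\<phi> x \<noteq> 0"
  note [measurable] = bounded_linear_measurable_gaussian[OF \<phi>]
  have "AE x in \<mu>. \<phi> x = 0"
    using assms(3) integral_nonneg_eq_0_iff_AE[OF centered_gaussian_second_moment_char(1)[OF \<phi>]] by simp
  then have "emeasure \<mu> {x\<in>space \<mu>. \<not> \<phi> x = 0} = 0"
    by (subst (asm) AE_iff_measurable[OF _ refl]) auto
  moreover have "open {x. \<phi> x \<noteq> 0}"
    using linear_continuous_on[OF \<phi>] by (intro open_Collect_neq) auto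
  then have "emeasure \<mu> {x. \<phi> x \<noteq> 0} > 0"
    using supp x by (auto simp: measure_support_def)
  ultimately show False by (simp add: centered_gaussian_space)
qed

text \<open>\<open>m\<close> is the rank and may be smaller than \<open>n\<close>: a residual of
  zero variance vanishes identically and adds no new \<psi>. The expansions hold at every point, so
  slab conditions on \<phi> can be rewritten in terms of \<psi> without null sets.\<close>

lemma gaussian_Gram_Schmidt:
  fixes \<phi> :: "nat \<Rightarrow> 'a \<Rightarrow> real"
  assumes supp: "measure_support \<mu> = UNIV" and \<phi>: "\<And>i. bounded_linear (\<phi> i)"
  shows "\<exists>m (\<psi> :: nat \<Rightarrow> 'a \<Rightarrow> real) c. (\<forall>j. bounded_linear (\<psi> j)) \<and>
    (\<forall>i<m. \<forall>j<m. (LINT x|\<mu>. \<psi> i x * \<psi> j x) = (if i = j then 1 else 0)) \<and>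
    (\<forall>i<n. \<forall>x. \<phi> i x = (\<Sum>j<m. c i j * \<psi> j x))"
proof (induction n)
  case 0
  show ?case by (rule exI[of _ "0::nat"], rule exI[of _ "\<lambda>_ _. 0"], rule exI[of _ "\<lambda>_ _. 0"]) (simp add: bounded_linear_zero)
next
  case (Suc n)
  then obtain m and \<psi> :: "nat \<Rightarrow> 'a \<Rightarrow> real" and c where *: "\<forall>j. bounded_linear (\<psi> j)"
    "\<forall>i<m. \<forall>j<m. (LINT x|\<mu>. \<psi> i x * \<psi> j x) = (if i = j then 1 else 0)"
    "\<forall>i<n. \<forall>x. \<phi> i x = (\<Sum>j<m. c i j * \<psi> j x)"
    by (elim exE conjE)
  note \<psi> = *(1)[rule_format] and orth = *(2)[rule_format] and span = *(3)[rule_format]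
  define d where "d j = (LINT x|\<mu>. \<phi> n x * \<psi> j x)" for j
  define r where "r x = \<phi> n x - (\<Sum>j<m. d j * \<psi> j x)" for x
  have r: "bounded_linear r"
    unfolding r_def by (intro bounded_linear_sub bounded_linear_sum bounded_linear_const_mult \<phi> \<psi>)
  have ro: "(LINT x|\<mu>. r x * \<psi> i x) = 0" if "i < m" for i
  proof -
    have int: "integrable \<mu> (\<lambda>x. d j * (\<psi> j x * \<psi> i x))" for j
      by (intro integrable_mult_right integrable_gaussian_mult[OF \<psi> \<psi>])
    have "(LINT x|\<mu>. r x * \<psi> i x) = (LINT x|\<mu>. \<phi> n x * \<psi> i x - (\<Sum>j<m. d j * (\<psi> j x * \<psi> i x)))"
      by (intro Bochner_Integration.integral_cong) (auto simp: r_def left_diff_distrib sum_distrib_right mult.assoc)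
    also have "\<dots> = (LINT x|\<mu>. \<phi> n x * \<psi> i x) - (LINT x|\<mu>. (\<Sum>j<m. d j * (\<psi> j x * \<psi> i x)))"
      by (rule Bochner_Integration.integral_diff[OF integrable_gaussian_mult[OF \<phi> \<psi>] Bochner_Integration.integrable_sum[OF int]])
    also have "\<dots> = d i - (\<Sum>j<m. d j * (LINT x|\<mu>. \<psi> j x * \<psi> i x))"
      by (simp only: d_def[of i, symmetric] Bochner_Integration.integral_sum[OF int] integral_mult_right_zero)
    also have "(\<Sum>j<m. d j * (LINT x|\<mu>. \<psi> j x * \<psi> i x)) = (\<Sum>j<m. if j = i then d j else 0)"
      using that by (intro sum.cong) (auto simp: orth)
    finally show ?thesis using that by simp
  qed
  show ?case
  proof (cases "(LINT x|\<mu>. (r x)\<^sup>2) = 0")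
    case True
    then have "\<phi> n x = (\<Sum>j<m. d j * \<psi> j x)" for x
      using gaussian_variance_zero[OF supp r True, of x] by (simp add: r_def)
    then have "\<forall>i<Suc n. \<forall>x. \<phi> i x = (\<Sum>j<m. (c(n := d)) i j * \<psi> j x)"
      using span by (auto simp: less_Suc_eq)
    then show ?thesis using *(1,2) by blast
  next
    case False
    define s where "s = sqrt (LINT x|\<mu>. (r x)\<^sup>2)"
    have "(LINT x|\<mu>. (r x)\<^sup>2) \<ge> 0" by simp
    then have rpos: "(LINT x|\<mu>. (r x)\<^sup>2) > 0" using False by linarith
    then have s: "s > 0" "s\<^sup>2 = (LINT x|\<mu>. (r x)\<^sup>2)" by (simp_all add: s_def)
    define \<psi>' where "\<psi>' = \<psi>(m := \<lambda>x. r x / s)"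
    \<comment> \<open>The old functionals get coefficient 0 in the new direction
      \<open>r / s\<close>; the new one gets \<open>s\<close>, since its residual is
      \<open>s * (r / s)\<close>.\<close>
    define c' where "c' i = (if i = n then d(m := s) else (c i)(m := 0))" for i
    have "bounded_linear (\<psi>' j)" for j
    proof (cases "j = m")
      case True
      then show ?thesis using bounded_linear_const_mult[OF r, of "1 / s"] by (simp add: \<psi>'_def)
    qed (simp add: \<psi>'_def \<psi>)
    moreover have "(LINT x|\<mu>. \<psi>' i x * \<psi>' j x) = (if i = j then 1 else 0)" if "i < Suc m" "j < Suc m" for i j
    proof -
      have 1: "(LINT x|\<mu>. r x / s * \<psi> k x) = 0" "(LINT x|\<mu>. \<psi> k x * (r x / s)) = 0" if "k < m" for k
        using ro[OF that] by (auto simp: mult.commute[of "\<psi> k _"])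
      have 2: "(LINT x|\<mu>. r x / s * (r x / s)) = 1"
        using s rpos by (simp add: power2_eq_square[symmetric] power_divide)
      from that 1 2 orth show ?thesis unfolding \<psi>'_def by (auto simp: less_Suc_eq)
    qed
    moreover have "\<phi> i x = (\<Sum>j<Suc m. c' i j * \<psi>' j x)" if "i < Suc n" for i x
    proof -
      have "\<phi> n x = (\<Sum>j<m. d j * \<psi> j x) + s * (r x / s)" using s by (simp add: r_def)
      moreover have "(\<Sum>j<Suc m. c' i j * \<psi>' j x) = (\<Sum>j<m. c' i j * \<psi> j x) + c' i m * (r x / s)"
        by (auto simp: \<psi>'_def)
      moreover have "(\<Sum>j<m. c' i j * \<psi> j x) = (\<Sum>j<m. (if i = n then d j else c i j) * \<psi> j x)"
        by (intro sum.cong) (auto simp: c'_def)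
      ultimately show ?thesis using that span by (cases "i = n") (auto simp: c'_def less_Suc_eq)
    qed
    ultimately show ?thesis
      by (intro exI[of _ "Suc m"] exI[of _ \<psi>'] exI[of _ c'] conjI allI impI)
  qed
qed

text \<open>By orthonormality the functional with coefficients \<open>a\<close> has variance equal
  to the sum of their squares, which is the characteristic function of independent standard
  normals.\<close>

lemma gaussian_orthonormal_distr:
  fixes \<psi> :: "nat \<Rightarrow> 'a \<Rightarrow> real"
  assumes \<psi>: "\<And>j. bounded_linear (\<psi> j)"
    and orth: "\<And>i j. i < m \<Longrightarrow> j < m \<Longrightarrow> (LINT x|\<mu>. \<psi> i x * \<psi> j x) = (if i = j then 1 else 0)"
  shows "distr \<mu> (PiM {..<m} (\<lambda>_. std_normal_distribution)) (\<lambda>x. \<lambda>j\<in>{..<m}. \<psi> j x) =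
    PiM {..<m} (\<lambda>_. std_normal_distribution)"
proof (rule prob_space.distr_PiM_std_normal[OF centered_gaussian_prob_space])
  show "\<psi> j \<in> borel_measurable \<mu>" for j by (intro bounded_linear_measurable_gaussian \<psi>)
  fix a :: "nat \<Rightarrow> real"
  have int: "integrable \<mu> (\<lambda>x. a i * a j * (\<psi> i x * \<psi> j x))" for i j
    by (intro integrable_mult_right integrable_gaussian_mult[OF \<psi> \<psi>])
  have "(LINT x|\<mu>. (\<Sum>j<m. a j * \<psi> j x)\<^sup>2) = (LINT x|\<mu>. (\<Sum>i<m. \<Sum>j<m. a i * a j * (\<psi> i x * \<psi> j x)))"
    by (intro Bochner_Integration.integral_cong) (auto simp: power2_eq_square sum_product ac_simps)
  also have "\<dots> = (\<Sum>i<m. \<Sum>j<m. a i * a j * (LINT x|\<mu>. \<psi> i x * \<psi> j x))"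
    by (simp only: Bochner_Integration.integral_sum[OF Bochner_Integration.integrable_sum[OF int]]
      Bochner_Integration.integral_sum[OF int] integral_mult_right_zero)
  also have "\<dots> = (\<Sum>i<m. \<Sum>j<m. if i = j then a i * a j else 0)"
    by (intro sum.cong) (auto simp: orth)
  also have "\<dots> = (\<Sum>i<m. (a i)\<^sup>2)" by (simp add: power2_eq_square)
  finally show "(CLINT x|\<mu>. iexp (\<Sum>j<m. a j * \<psi> j x)) = of_real (exp (- (\<Sum>j<m. (a j)\<^sup>2) / 2))"
    by (subst centered_gaussian_second_moment_char(2))
       (auto intro!: bounded_linear_sum bounded_linear_const_mult \<psi>)
qed

text \<open>Prekopa--Leindler for a slab intersection, its reflection and the centred one. The first two have
  equal measure because \<open>\<psi>\<close> and \<open>- \<psi>\<close> have the same law.\<close>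

lemma Anderson_slabs:
  fixes \<phi> :: "nat \<Rightarrow> 'a \<Rightarrow> real"
  assumes supp: "measure_support \<mu> = UNIV" and \<phi>: "\<And>i. bounded_linear (\<phi> i)"
  shows "measure \<mu> {x. \<forall>i<n. \<bar>\<phi> i x - b i\<bar> \<le> t} \<le> measure \<mu> {x. \<forall>i<n. \<bar>\<phi> i x\<bar> \<le> t}"
proof -
  obtain m and \<psi> :: "nat \<Rightarrow> 'a \<Rightarrow> real" and c where *: "\<forall>j. bounded_linear (\<psi> j)"
    "\<forall>i<m. \<forall>j<m. (LINT x|\<mu>. \<psi> i x * \<psi> j x) = (if i = j then 1 else 0)"
    "\<forall>i<n. \<forall>x. \<phi> i x = (\<Sum>j<m. c i j * \<psi> j x)"
    using gaussian_Gram_Schmidt[where \<phi>=\<phi> and n=n, OF supp \<phi>] by (elim exE conjE)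
  note \<psi> = *(1)[rule_format] and orth = *(2)[rule_format] and span = *(3)[rule_format]
  define P where "P = PiM {..<m} (\<lambda>_. std_normal_distribution)"
  interpret P: prob_space P unfolding P_def by (intro prob_space_PiM prob_space_std_normal)
  define K where "K b = {y\<in>space P. \<forall>i<n. \<bar>(\<Sum>j<m. c i j * y j) - b i\<bar> \<le> t}" for b
  have [measurable]: "K b \<in> sets P" for b unfolding K_def P_def by measurable
  \<comment> \<open>Stated for any orthonormal \<theta>, because it serves both \<psi> and its
    negative; the latter yields the mass of the reflected set.\<close>
  have law: "measure P (K b) = measure \<mu> {x. \<forall>i<n. \<bar>(\<Sum>j<m. c i j * \<theta> j x) - b i\<bar> \<le> t}"
    if \<theta>: "\<And>j. bounded_linear (\<theta> j)"
      "\<And>i j. i < m \<Longrightarrow> j < m \<Longrightarrow> (LINT x|\<mu>. \<theta> i x * \<theta> j x) = (if i = j then 1 else 0)"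
    for \<theta> :: "nat \<Rightarrow> 'a \<Rightarrow> real" and b
  proof -
    note [measurable] = bounded_linear_measurable_gaussian[OF \<theta>(1)]
    have "(\<lambda>x. \<lambda>j\<in>{..<m}. \<theta> j x) \<in> \<mu> \<rightarrow>\<^sub>M P" unfolding P_def by (rule measurable_restrict) simp
    then have "measure (distr \<mu> P (\<lambda>x. \<lambda>j\<in>{..<m}. \<theta> j x)) (K b) = measure \<mu> {x. \<forall>i<n. \<bar>(\<Sum>j<m. c i j * \<theta> j x) - b i\<bar> \<le> t}"
      by (subst measure_distr) (auto simp: K_def centered_gaussian_space P_def space_PiM intro!: arg_cong2[where f=measure])
    moreover have "distr \<mu> P (\<lambda>x. \<lambda>j\<in>{..<m}. \<theta> j x) = P"
      unfolding P_def by (rule gaussian_orthonormal_distr) (rule \<theta>, assumption?)+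
    ultimately show ?thesis by simp
  qed
  have Kb: "measure P (K b) = measure \<mu> {x. \<forall>i<n. \<bar>\<phi> i x - b i\<bar> \<le> t}" for b
    using law[OF \<psi> orth, of b] span by simp
  have "measure P (K (\<lambda>i. - b i)) = measure \<mu> {x. \<forall>i<n. \<bar>(\<Sum>j<m. c i j * - \<psi> j x) - - b i\<bar> \<le> t}"
    using orth by (intro law bounded_linear_minus \<psi>) simp
  also have "\<dots> = measure \<mu> {x. \<forall>i<n. \<bar>\<phi> i x - b i\<bar> \<le> t}"
    using span by (intro arg_cong2[where f=measure] refl Collect_cong) (auto simp: sum_negf)
  finally have Kmb: "measure P (K (\<lambda>i. - b i)) = measure P (K b)" by (simp add: Kb)
  have "(LINT x|P. indicator (K b) x) * (LINT x|P. indicator (K (\<lambda>i. - b i)) x) \<le> (LINT x|P. indicator (K (\<lambda>_. 0)) x :: real)\<^sup>2"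
    unfolding P_def
  proof (rule Prekopa_Leindler_PiM_std_normal, unfold P_def[symmetric])
    fix x y assume xy: "x \<in> space P" "y \<in> space P"
    define z where "z = (\<lambda>i\<in>{..<m}. (x i + y i) / 2)"
    have z: "z \<in> space P" by (auto simp: z_def P_def space_PiM)
    \<comment> \<open>The centres \<open>b\<close> and \<open>- b\<close> cancel when the two points
      are averaged.\<close>
    have "z \<in> K (\<lambda>_. 0)" if "x \<in> K b" "y \<in> K (\<lambda>i. - b i)"
      unfolding K_def
    proof (intro CollectI conjI allI impI z)
      fix i assume i: "i < n"
      have "(\<Sum>j<m. c i j * z j) = ((\<Sum>j<m. c i j * x j) + (\<Sum>j<m. c i j * y j)) / 2"
        unfolding sum.distrib[symmetric] sum_divide_distrib
        by (intro sum.cong) (auto simp: z_def algebra_simps add_divide_distrib)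
      moreover have "\<bar>(\<Sum>j<m. c i j * x j) - b i\<bar> \<le> t" "\<bar>(\<Sum>j<m. c i j * y j) - - b i\<bar> \<le> t"
        using that i by (auto simp: K_def)
      moreover have "\<bar>(u + v) / 2\<bar> \<le> t" if "\<bar>u - w\<bar> \<le> t" "\<bar>v - - w\<bar> \<le> t" for u v w :: real
        using that unfolding abs_le_iff by (auto simp: field_simps)
      ultimately show "\<bar>(\<Sum>j<m. c i j * z j) - 0\<bar> \<le> t" by simp
    qed
    then show "indicator (K b) x * indicator (K (\<lambda>i. - b i)) y \<le> (indicator (K (\<lambda>_. 0)) z :: real)\<^sup>2"
      by (auto split: split_indicator)
  qed (auto split: split_indicator)
  then have "(measure P (K b))\<^sup>2 \<le> (measure P (K (\<lambda>_. 0)))\<^sup>2"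
    by (simp add: Kmb power2_eq_square)
  then have "measure P (K b) \<le> measure P (K (\<lambda>_. 0))" by (rule power2_le_imp_le) simp
  then show ?thesis by (simp add: Kb)
qed

end

text \<open>The slabs cutting out the ball around \<open>z\<close> are centred at
  \<open>\<phi> i z\<close>; continuity from above passes from finitely many of them to the
  ball.\<close>

lemma Anderson_cball:
  fixes \<mu> :: "'a::{real_normed_vector, second_countable_topology} measure"
  assumes gauss: "centered_gaussian \<mu>" and supp: "measure_support \<mu> = UNIV"
  shows "measure \<mu> (cball z t) \<le> measure \<mu> (cball 0 t)"
proof -
  interpret prob_space \<mu> using gauss by (rule centered_gaussian_prob_space)
  obtain \<phi> :: "nat \<Rightarrow> 'a \<Rightarrow> real" where \<phi>: "\<And>n. bounded_linear (\<phi> n)"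
    and norm: "\<And>x t. norm x \<le> t \<longleftrightarrow> (\<forall>n. \<bar>\<phi> n x\<bar> \<le> t)"
    using countable_norming_functionals by blast
  note [measurable] = bounded_linear_measurable_gaussian[OF gauss \<phi>]
  define S where "S z n = {x. \<forall>i<n. \<bar>\<phi> i x - \<phi> i z\<bar> \<le> t}" for z n
  have lim: "(\<lambda>n. measure \<mu> (S z n)) \<longlonglongrightarrow> measure \<mu> (cball z t)" for z
  proof -
    have "x \<in> cball z t \<longleftrightarrow> (\<forall>i. \<bar>\<phi> i x - \<phi> i z\<bar> \<le> t)" for x
      using norm[of "x - z" t] by (simp add: dist_norm norm_minus_commute[of z] linear_diff[OF bounded_linear.linear[OF \<phi>]])
    then have "cball z t = (\<Inter>n. S z n)" unfolding S_def by blast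
    moreover have "{x\<in>space \<mu>. \<forall>i<n. \<bar>\<phi> i x - \<phi> i z\<bar> \<le> t} \<in> sets \<mu>" for n by measurable
    then have "range (S z) \<subseteq> sets \<mu>" using gauss by (auto simp: S_def centered_gaussian_space)
    moreover have "decseq (S z)" by (auto simp: decseq_def S_def)
    ultimately show ?thesis using finite_Lim_measure_decseq[of "S z"] by simp
  qed
  have "measure \<mu> (S z n) \<le> measure \<mu> (S 0 n)" for n
    using Anderson_slabs[where \<phi>=\<phi> and n=n and b="\<lambda>i. \<phi> i z" and t=t, OF gauss supp \<phi>]
    by (simp add: S_def linear_0[OF bounded_linear.linear[OF \<phi>]])
  then show ?thesis using LIMSEQ_le[OF lim lim] by blast
qed

section \<open>Optimal quantization\<close>

text \<open>The maximal fibre mass is attained and positive, so the logarithm can be inverted. On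
  the right \<open>z\<close> may be any point, because fibres outside the range are empty and have
  mass 0.\<close>

lemma renyi_inf_entropy_le_iff:
  fixes M :: "'a::t1_space measure"
  assumes "prob_space M" "sets M = sets borel" "f \<in> quantizers"
  shows "renyi_inf_entropy M f \<le> R \<longleftrightarrow> (\<exists>z. exp (- R) \<le> measure M (f -` {z}))"
proof -
  obtain z where z: "z \<in> range f" "measure M (f -` {z}) > 0"
    "\<And>w. w \<in> range f \<Longrightarrow> measure M (f -` {w}) \<le> measure M (f -` {z})"
    using quantizer_max_attained[OF assms] by blast
  have w: "measure M (f -` {w}) \<le> measure M (f -` {z})" for w
  proof (cases "w \<in> range f")
    case False
    then have "f -` {w} = {}" by auto
    then show ?thesis by simp
  qed (rule z)
  have "(GREATEST m. m \<in> {measure M (f -` {z}) | z. z \<in> range f}) = measure M (f -` {z})"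
    using z by (intro Greatest_equality) auto
  then have "renyi_inf_entropy M f \<le> R \<longleftrightarrow> - R \<le> ln (measure M (f -` {z}))"
    by (auto simp: renyi_inf_entropy_def)
  also have "\<dots> \<longleftrightarrow> exp (- R) \<le> measure M (f -` {z})"
    using z(2) by (rule ln_ge_iff)
  also have "\<dots> \<longleftrightarrow> (\<exists>z. exp (- R) \<le> measure M (f -` {z}))"
    using w by (meson order_trans)
  finally show ?thesis .
qed

text \<open>The preimage \<open>r\<close> of a level turns superlevel sets of
  \<open>\<rho> (norm (x - w))\<close> into complements of balls, the form in which Anderson's
  inequality applies.\<close>

lemma strict_mono_on_surj_imp_level:
  fixes \<rho> :: "real \<Rightarrow> real"
  assumes "\<rho> ` {0..} = {0..}" "strict_mono_on {0..} \<rho>" "u \<ge> 0"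
  obtains r where "r \<ge> 0" "\<rho> r = u" "\<And>t. t \<ge> 0 \<Longrightarrow> u < \<rho> t \<longleftrightarrow> r < t"
proof -
  obtain r where "r \<ge> 0" "\<rho> r = u" using assms(1,3) by (metis atLeast_iff imageE)
  then show thesis
    using that strict_mono_on_less[OF assms(2)] by force
qed

text \<open>Bathtub principle: any other ball captures at most as much mass, so at every level \<open>u\<close> the
  superlevel set of the integrand inside \<open>A\<close> has at least the mass of the one inside the centred ball.\<close>

lemma error_on_cell_ge:
  fixes \<mu> :: "'a::{real_normed_vector, second_countable_topology} measure"
  assumes gauss: "centered_gaussian \<mu>" and supp: "measure_support \<mu> = UNIV"
    and \<rho>: "\<rho> ` {0..} = {0..}" "strict_mono_on {0..} \<rho>" "continuous_on {0..} \<rho>"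
    and A: "A \<in> sets borel" "measure \<mu> (cball 0 s) \<le> measure \<mu> A"
  shows "(\<integral>\<^sup>+ x \<in> cball 0 s. ennreal (\<rho> (norm x)) \<partial>\<mu>) \<le> (\<integral>\<^sup>+ x \<in> A. ennreal (\<rho> (norm (x - z))) \<partial>\<mu>)"
proof -
  interpret prob_space \<mu> using gauss by (simp add: centered_gaussian_def)
  have sets[measurable_cong, simp]: "sets \<mu> = sets borel" using gauss by (simp add: centered_gaussian_def)
  have space[simp]: "space \<mu> = UNIV" using sets_eq_imp_space_eq[OF sets] by simp
  have [measurable]: "(\<lambda>x. \<rho> (norm (x - w))) \<in> borel_measurable borel" for w :: 'a
    by (intro borel_measurable_continuous_onI continuous_on_compose2[OF \<rho>(3)]) (auto intro!: continuous_intros)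
  have cake: "(\<integral>\<^sup>+ x \<in> C. ennreal (\<rho> (norm (x - w))) \<partial>\<mu>) =
      (\<integral>\<^sup>+ u. indicator {0..} u * emeasure \<mu> {x \<in> C. u < \<rho> (norm (x - w))} \<partial>lborel)"
    if [measurable]: "C \<in> sets borel" for C w
  proof -
    have "(\<integral>\<^sup>+ x \<in> C. ennreal (\<rho> (norm (x - w))) \<partial>\<mu>) = (\<integral>\<^sup>+ x. ennreal (indicator C x * \<rho> (norm (x - w))) \<partial>\<mu>)"
      by (intro nn_integral_cong) (auto split: split_indicator)
    also have "\<dots> = (\<integral>\<^sup>+ u. indicator {0..} u * emeasure \<mu> {x \<in> space \<mu>. u < indicator C x * \<rho> (norm (x - w))} \<partial>lborel)"
      by (intro nn_integral_layer_cake) measurable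
    also have "\<dots> = (\<integral>\<^sup>+ u. indicator {0..} u * emeasure \<mu> {x \<in> C. u < \<rho> (norm (x - w))} \<partial>lborel)"
      by (intro nn_integral_cong) (auto split: split_indicator intro!: arg_cong[where f="emeasure \<mu>"])
    finally show ?thesis .
  qed
  have "emeasure \<mu> {x \<in> cball 0 s. u < \<rho> (norm (x - 0))} \<le> emeasure \<mu> {x \<in> A. u < \<rho> (norm (x - z))}"
    if "u \<ge> 0" for u
  proof -
    obtain r where r: "\<And>t. t \<ge> 0 \<Longrightarrow> u < \<rho> t \<longleftrightarrow> r < t"
      using strict_mono_on_surj_imp_level[OF \<rho>(1,2) \<open>u \<ge> 0\<close>] by metis
    have level: "{x \<in> C. u < \<rho> (norm (x - w))} = C - cball w r" for C and w :: 'a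
      using r by (auto simp: dist_norm norm_minus_commute)
    have "measure \<mu> (cball 0 s - cball 0 r) \<le> measure \<mu> (A - cball z r)"
    proof (cases "s \<le> r")
      case True
      then have "cball 0 s - cball 0 r = ({} :: 'a set)" by auto
      then show ?thesis by (simp only: measure_empty measure_nonneg)
    next
      case False
      then have "measure \<mu> (cball 0 s - cball 0 r) = measure \<mu> (cball 0 s) - measure \<mu> (cball 0 r)"
        by (intro finite_measure_Diff) auto
      also have "\<dots> \<le> measure \<mu> A - measure \<mu> (cball z r)"
        using A(2) Anderson_cball[OF gauss supp, of z r] by linarith
      \<comment> \<open>\<open>cball z r\<close> need not lie in \<open>A\<close>, so removing it
        costs at most its mass; for the centred ball inside \<open>cball 0 s\<close> the cost was
        exactly its mass.\<close>
      also have "\<dots> \<le> measure \<mu> (A - cball z r)"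
        using measure_Un_le[of "A - cball z r" \<mu> "cball z r"]
          finite_measure_mono[of A "(A - cball z r) \<union> cball z r"] A(1) by auto
      finally show ?thesis .
    qed
    then show ?thesis unfolding level by (simp add: emeasure_eq_measure)
  qed
  then show ?thesis
    using cake[of "cball 0 s" 0] cake[OF A(1), of z]
    by (auto intro!: nn_integral_mono split: split_indicator)
qed

text \<open>Outside \<open>C\<close> each point goes to the first term of a dense sequence within
  distance \<delta>. Taking the least index makes the choice measurable, and the image stays
  countable.\<close>

lemma quantizer_collapsing_exists:
  fixes C :: "'a::{real_normed_vector, second_countable_topology} set"
  assumes [measurable]: "C \<in> sets borel" and "\<delta> > 0"
  obtains f where "f \<in> quantizers" "\<And>x. x \<in> C \<Longrightarrow> f x = c" "\<And>x. x \<notin> C \<Longrightarrow> norm (x - f x) \<le> \<delta>"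
proof -
  obtain D :: "'a set" where D: "countable D" "\<And>X. open X \<Longrightarrow> X \<noteq> {} \<Longrightarrow> \<exists>d\<in>D. d \<in> X"
    using countable_dense_setE by blast
  have "D \<noteq> {}" using D(2)[of UNIV] by auto
  define d where "d = from_nat_into D"
  have ex: "\<exists>n. norm (x - d n) \<le> \<delta>" for x
  proof -
    obtain y where "y \<in> D" "y \<in> ball x \<delta>" using D(2)[of "ball x \<delta>"] \<open>\<delta> > 0\<close> by auto
    moreover obtain n where "d n = y"
      using D(1) \<open>D \<noteq> {}\<close> \<open>y \<in> D\<close> by (metis d_def from_nat_into_surj)
    ultimately show ?thesis by (auto simp: dist_norm intro!: exI[of _ n])
  qed
  define N where "N x = (LEAST n. norm (x - d n) \<le> \<delta>)" for x
  have N[measurable]: "N \<in> borel \<rightarrow>\<^sub>M count_space UNIV" unfolding N_def by measurable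
  have dN[measurable]: "(\<lambda>x. d (N x)) \<in> borel \<rightarrow>\<^sub>M borel"
    by (rule measurable_compose[OF N]) simp
  define f where "f x = (if x \<in> C then c else d (N x))" for x
  have "f \<in> borel \<rightarrow>\<^sub>M borel" unfolding f_def by measurable
  moreover have "range f \<subseteq> insert c (range d)" by (auto simp: f_def)
  then have "countable (range f)" by (rule countable_subset) auto
  moreover have "norm (x - d (N x)) \<le> \<delta>" for x
    unfolding N_def using ex[of x] by (rule LeastI_ex)
  ultimately show thesis by (intro that[of f]) (auto simp: quantizers_def f_def)
qed

theorem proposition2p3:
  fixes \<mu> :: "'a::{banach, second_countable_topology} measure"
    and \<rho> :: "real \<Rightarrow> real"
    and R s :: real
  assumes "infinite_dimensional TYPE('a)"
    and "centered_gaussian \<mu>"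
    and "nonatomic \<mu>"
    and "measure_support \<mu> = UNIV"
    and "\<rho> ` {0..} = {0..}"
    and "strict_mono_on {0..} \<rho>"
    and "continuous_on {0..} \<rho>"
    and "\<rho> 0 = 0"
    and "(\<integral>\<^sup>+ x. ennreal (\<rho> (norm x)) \<partial>\<mu>) < \<infinity>"
    and "R > 0"
    and "s > 0"
    and "measure \<mu> (cball 0 s) = exp (- R)"
  shows "optimal_quantization_error \<mu> \<rho> R = (\<integral>\<^sup>+ x \<in> cball 0 s. ennreal (\<rho> (norm x)) \<partial>\<mu>)"
proof (rule antisym)
  note gauss = assms(2) and supp = assms(4) and \<rho> = assms(5-7) and ball = assms(12)
  interpret prob_space \<mu> using gauss by (simp add: centered_gaussian_def)
  have sets[measurable_cong, simp]: "sets \<mu> = sets borel" using gauss by (simp add: centered_gaussian_def)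
  have space[simp]: "space \<mu> = UNIV" using sets_eq_imp_space_eq[OF sets] by simp
  note renyi = renyi_inf_entropy_le_iff[OF prob_space_axioms sets]
  have [measurable]: "(\<lambda>x. \<rho> (norm x)) \<in> borel_measurable borel"
    by (intro borel_measurable_continuous_onI continuous_on_compose2[OF \<rho>(3)]) (auto intro!: continuous_intros)
  let ?I = "\<integral>\<^sup>+ x \<in> cball 0 s. ennreal (\<rho> (norm x)) \<partial>\<mu>"
  show "?I \<le> optimal_quantization_error \<mu> \<rho> R"
    unfolding optimal_quantization_error_def
  proof (rule Inf_greatest, clarify)
    fix f :: "'a \<Rightarrow> 'a" assume f: "f \<in> quantizers" "renyi_inf_entropy \<mu> f \<le> R"
    then obtain z where z: "exp (- R) \<le> measure \<mu> (f -` {z})" using renyi by blast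
    have A: "f -` {z} \<in> sets borel"
      using f(1) measurable_sets[of f borel borel "{z}"] by (auto simp: quantizers_def)
    have "?I \<le> (\<integral>\<^sup>+ x \<in> f -` {z}. ennreal (\<rho> (norm (x - z))) \<partial>\<mu>)"
      using z ball by (intro error_on_cell_ge[OF gauss supp \<rho> A]) simp
    also have "\<dots> \<le> quantization_error \<mu> \<rho> f"
      unfolding quantization_error_def by (intro nn_integral_mono) (auto split: split_indicator)
    finally show "?I \<le> quantization_error \<mu> \<rho> f" .
  qed
  show "optimal_quantization_error \<mu> \<rho> R \<le> ?I"
  proof (rule ennreal_le_epsilon)
    fix e :: real assume e: "e > 0"
    \<comment> \<open>A displacement of at most \<delta> costs at most \<open>e\<close> by
      monotonicity, also after integration since \<mu> has mass 1.\<close>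
    obtain \<delta> where \<delta>: "\<delta> \<ge> 0" "\<rho> \<delta> = e" using \<rho>(1) e by (metis atLeast_iff imageE less_imp_le)
    then have "\<delta> > 0" using assms(8) e by (cases "\<delta> = 0") auto
    then obtain f :: "'a \<Rightarrow> 'a" where f: "f \<in> quantizers" "\<And>x. x \<in> cball 0 s \<Longrightarrow> f x = 0"
      "\<And>x. x \<notin> cball 0 s \<Longrightarrow> norm (x - f x) \<le> \<delta>"
      using quantizer_collapsing_exists[of "cball 0 s :: 'a set" \<delta> 0] by auto
    \<comment> \<open>Only an inequality: points outside the ball may be sent to the origin as
      well.\<close>
    have "measure \<mu> (cball 0 s) \<le> measure \<mu> (f -` {0})"
      using f(1,2) measurable_sets[of f borel borel "{0}"] by (intro finite_measure_mono) (auto simp: quantizers_def)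
    then have "renyi_inf_entropy \<mu> f \<le> R" using renyi[OF f(1)] ball by metis
    then have "optimal_quantization_error \<mu> \<rho> R \<le> quantization_error \<mu> \<rho> f"
      unfolding optimal_quantization_error_def using f(1) by (intro Inf_lower) blast
    also have "\<dots> \<le> (\<integral>\<^sup>+ x. ennreal (\<rho> (norm x)) * indicator (cball 0 s) x + ennreal e \<partial>\<mu>)"
      unfolding quantization_error_def
    proof (intro nn_integral_mono)
      fix x
      have "\<rho> (norm (x - f x)) \<le> e" if "x \<notin> cball 0 s"
        using f(3)[OF that] strict_mono_on_leD[OF \<rho>(2), of "norm (x - f x)" \<delta>] \<delta> by auto
      then show "ennreal (\<rho> (norm (x - f x))) \<le> ennreal (\<rho> (norm x)) * indicator (cball 0 s) x + ennreal e"
        using f(2)[of x] by (cases "x \<in> cball 0 s") (auto intro: ennreal_leI)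
    qed
    also have "\<dots> = ?I + ennreal e"
    proof (subst nn_integral_add)
      have [measurable]: "cball 0 s \<in> sets (borel :: 'a measure)" by simp
      show "(\<lambda>x. ennreal (\<rho> (norm x)) * indicator (cball 0 s) x) \<in> borel_measurable \<mu>"
        by measurable
    qed (simp_all add: emeasure_space_1[unfolded space])
    finally show "optimal_quantization_error \<mu> \<rho> R \<le> ?I + ennreal e" .
  qed
qed

end
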